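(* Let $b,r\ge1$ and let $S$ be a standard skew tableau with $b$ rows, each of size $r$. Let $w_1,\dots,w_b$ be the words formed by the entries of the rows of $S$, each read left to right, where $w_1$ is the bottom row and $w_b$ is the top row. For $i=1,\dots,b-1$ let $$c_i=(\text{length of the first row of } P(w_iw_{i+1}))-r,$$ where $w_iw_{i+1}$ is the concatenation. Then for every integer $k\ge b-1$, $\operatorname{Rect}(S^{(k)})$ has shape $(\lambda_1,\dots,\lambda_b)$ with $$\lambda_j=kr+\sum_{i=1}^{b-j}c_i-\sum_{i=1}^{j-1}c_i\qquad (j=1,\dots,b).$$
   Context: $P(w)$ denotes the Robinson–Schensted row-insertion tableau of a word $w$. Tableaux use English notation. $\operatorname{Rect}$ denotes jeu de taquin rectification. For a standard skew tableau $S$ with $m$ cells whose row lengths weakly decrease from top to bottom and $k\ge 1$, $S^{(k)}$ is the standard skew tableau obtained by attaching $k-1$ shifted copies of $S$ to the right of $S$: row $i$ of $S^{(k)}$ begins in the same column as row $i$ of $S$ and consists of the entries of row $i$ of $S$, followed by these entries plus $m$, followed by these entries plus $2m$, ..., followed by these entries plus $(k-1)m$. *)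

theory Defs
  imports Main
begin

section \<open>Tableaux as partial fillings of cells (row, column), English notation, 0-indexed\<close>

type_synonym tab = "nat \<times> nat \<Rightarrow> nat option"

definition standard_tab :: "tab \<Rightarrow> bool" where
  "standard_tab T \<longleftrightarrow> finite (dom T) \<and> inj_on T (dom T)
     \<and> ran T = {1..card (dom T)}
     \<and> (\<forall>i j j'. (i,j) \<in> dom T \<longrightarrow> (i,j') \<in> dom T \<longrightarrow> j < j'
                 \<longrightarrow> the (T (i,j)) < the (T (i,j')))
     \<and> (\<forall>i i' j. (i,j) \<in> dom T \<longrightarrow> (i',j) \<in> dom T \<longrightarrow> i < i'
                 \<longrightarrow> the (T (i,j)) < the (T (i',j)))"

definition row_word :: "tab \<Rightarrow> nat \<Rightarrow> nat list" where
  "row_word T i = map (\<lambda>j. the (T (i,j))) (sorted_list_of_set {j. (i,j) \<in> dom T})"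

definition tab_pow :: "tab \<Rightarrow> nat \<Rightarrow> tab" where
  "tab_pow S k = (\<lambda>(i,j).
     (let cs = {j. (i,j) \<in> dom S} in
      if cs = {} then None else
      (let s = Min cs; L = card cs in
       if s \<le> j \<and> j < s + k * L
       then map_option (\<lambda>v. v + ((j - s) div L) * card (dom S)) (S (i, s + (j - s) mod L))
       else None)))"

definition ins_row :: "nat list \<Rightarrow> nat \<Rightarrow> nat list \<times> nat option" where
  "ins_row r x = (if \<forall>y\<in>set r. y \<le> x then (r @ [x], None)
     else (let p = (LEAST p. p < length r \<and> x < r ! p) in (r[p := x], Some (r ! p))))"

fun row_insert :: "nat list list \<Rightarrow> nat \<Rightarrow> nat list list" where
  "row_insert [] x = [[x]]"
| "row_insert (r # rs) x = (case ins_row r x of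
       (r', None) \<Rightarrow> r' # rs
     | (r', Some y) \<Rightarrow> r' # row_insert rs y)"

definition RS_P :: "nat list \<Rightarrow> nat list list" where
  "RS_P w = foldl row_insert [] w"

text \<open>Empty cells weakly north-west of some filled cell: the inner shape.\<close>
definition holes :: "tab \<Rightarrow> (nat \<times> nat) set" where
  "holes T = {c. c \<notin> dom T \<and> (\<exists>d\<in>dom T. fst c \<le> fst d \<and> snd c \<le> snd d)}"

fun slide_aux :: "nat \<Rightarrow> tab \<Rightarrow> nat \<times> nat \<Rightarrow> tab" where
  "slide_aux 0 T c = T"
| "slide_aux (Suc n) T (i,j) =
     (let right = slide_aux n (T((i,j) := T (i,j+1), (i,j+1) := None)) (i,j+1);
          down = slide_aux n (T((i,j) := T (i+1,j), (i+1,j) := None)) (i+1,j) in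
      (case (T (i,j+1), T (i+1,j)) of
         (None, None) \<Rightarrow> T
       | (Some x, None) \<Rightarrow> right
       | (None, Some y) \<Rightarrow> down
       | (Some x, Some y) \<Rightarrow> (if x < y then right else down)))"

definition slide :: "tab \<Rightarrow> nat \<times> nat \<Rightarrow> tab" where
  "slide T c = slide_aux (Suc (card (dom T))) T c"

text \<open>Canonical choice of inner corner: the last cell of the lowest row of the inner shape.\<close>
definition lexmax :: "(nat \<times> nat) set \<Rightarrow> nat \<times> nat" where
  "lexmax H = (let i = Max (fst ` H) in (i, Max {j. (i,j) \<in> H}))"

fun rect_aux :: "nat \<Rightarrow> tab \<Rightarrow> tab" where
  "rect_aux 0 T = T"
| "rect_aux (Suc n) T = (if holes T = {} then T else rect_aux n (slide T (lexmax (holes T))))"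

definition rect :: "tab \<Rightarrow> tab" where
  "rect T = rect_aux (card (holes T)) T"

definition has_shape :: "tab \<Rightarrow> nat \<Rightarrow> (nat \<Rightarrow> int) \<Rightarrow> bool" where
  "has_shape T b lam \<longleftrightarrow> (\<forall>j. 1 \<le> j \<and> j \<le> b \<longrightarrow> 0 \<le> lam j)
     \<and> dom T = {(i,j). i < b \<and> int j < lam (i+1)}"

end

theory Submission
  imports Defs
begin

text \<open>Encode a tableau by the word \<open>y\<close> whose \<open>t\<close>-th letter is the row of the entry \<open>t\<close>. A vertical
  step of a jeu de taquin slide changes one letter \<open>i + 1\<close> into \<open>i\<close>, at the first time where
  \<open>#(i + 1) - #i\<close> is maximal: it is a crystal raising operator. Consider the maximal number of
  letters of \<open>y\<close> that \<open>j\<close> non-intersecting lattice paths can collect, where the paths move weakly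
  towards the first row as time passes. Rerouting a path across the boundary between rows \<open>i\<close> and
  \<open>i + 1\<close> shows that raising operators preserve this number, and on a tableau of straight shape it
  is the sum of the first \<open>j\<close> row lengths. For \<open>S\<^sup>(\<^sup>k\<^sup>)\<close> the word is \<open>m\<close>-periodic; summation by parts
  bounds the number collected by the maximal excesses at the row boundaries (which are the
  \<open>c\<^sub>i\<close>), weighted by the numbers of crossings, and \<open>b - 1\<close> periods suffice to let every crossing
  happen at an optimal time.\<close>

text \<open>A single path collects letters that weakly decrease in time, so the path maximum is a
  lattice path form of Greene's invariants. Heights replace sets of positions because every
  condition becomes local: disjointness says that increments in \<open>p\<close> are 0 or 1, the
  direction of movement is monotonicity in \<open>t\<close>, and moving a path between rows
  \<open>i\<close> and \<open>i + 1\<close> changes the height only at \<open>Suc i\<close>.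
  Summation by parts then separates the boundaries: each crossing contributes the excess of its own
  boundary at its own time, so an upper bound may treat them independently. What ties them together
  is the order of the crossings, and the optimal times inside one period can be in the wrong order.
  Equal row lengths resolve this: the excess returns to 0 after each period, so a crossing can be
  postponed by whole periods at no cost. Row lengths are recovered as differences in
  \<open>j\<close> of the maxima.\<close>

section \<open>Lattice paths in words and raising operators\<close>

text \<open>A height path describes \<open>j\<close>-subsets \<open>A\<^sub>t\<close> of the rows \<open>{0..<B}\<close>, decreasing in \<open>t\<close>: \<open>F t p\<close> is the
  number of elements of \<open>A\<^sub>t\<close> below \<open>p\<close>. The path count is the number of \<open>t\<close> with \<open>y t \<in> A\<^sub>t\<close>.\<close>

definition height_path :: "nat \<Rightarrow> nat \<Rightarrow> (nat \<Rightarrow> nat \<Rightarrow> int) \<Rightarrow> bool" where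
  "height_path B j F \<longleftrightarrow> (\<forall>t. F t 0 = 0 \<and> F t B = int j)
     \<and> (\<forall>t p. p < B \<longrightarrow> F t p \<le> F t (Suc p) \<and> F t (Suc p) \<le> F t p + 1)
     \<and> (\<forall>t p. p \<le> B \<longrightarrow> F t p \<le> F (Suc t) p)"

lemma height_pathD:
  assumes "height_path B j F"
  shows "F t 0 = 0" "F t B = int j"
    and "p < B \<Longrightarrow> F t p \<le> F t (Suc p)" "p < B \<Longrightarrow> F t (Suc p) \<le> F t p + 1"
    and "p \<le> B \<Longrightarrow> F t p \<le> F (Suc t) p"
  using assms unfolding height_path_def by blast+

definition path_count :: "nat \<Rightarrow> (nat \<Rightarrow> nat) \<Rightarrow> (nat \<Rightarrow> nat \<Rightarrow> int) \<Rightarrow> int" where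
  "path_count n y F = (\<Sum>t=1..n. F t (Suc (y t)) - F t (y t))"

definition letter_count :: "(nat \<Rightarrow> nat) \<Rightarrow> nat \<Rightarrow> nat \<Rightarrow> int" where
  "letter_count y i t = (\<Sum>s=1..t. of_bool (y s = i))"

definition excess :: "(nat \<Rightarrow> nat) \<Rightarrow> nat \<Rightarrow> nat \<Rightarrow> int" where
  "excess y i t = letter_count y (Suc i) t - letter_count y i t"

text \<open>Stated as a relation (attained, and an upper bound): height paths are functions on all
  times, an infinite family to which \<open>Max\<close> does not apply directly.\<close>

definition greene :: "nat \<Rightarrow> nat \<Rightarrow> (nat \<Rightarrow> nat) \<Rightarrow> nat \<Rightarrow> int \<Rightarrow> bool" where
  "greene B n y j M \<longleftrightarrow> (\<exists>F. height_path B j F \<and> path_count n y F = M)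
     \<and> (\<forall>F. height_path B j F \<longrightarrow> path_count n y F \<le> M)"

lemma greene_unique: "greene B n y j M \<Longrightarrow> greene B n y j M' \<Longrightarrow> M = M'"
  unfolding greene_def by (meson dual_order.antisym)

lemma greene_transfer:
  assumes "greene B n y j M"
    and "\<And>F. height_path B j F \<Longrightarrow> \<exists>F'. height_path B j F' \<and> path_count n y F \<le> path_count n y' F'"
    and "\<And>F. height_path B j F \<Longrightarrow> \<exists>F'. height_path B j F' \<and> path_count n y' F \<le> path_count n y F'"
  shows "greene B n y' j M"
  using assms unfolding greene_def by (meson dual_order.antisym order.trans)

text \<open>The sign fits rerouting: a path moved from row \<open>i + 1\<close> to row
  \<open>i\<close> during these times changes its yield by this sum.\<close>

lemma excess_interval:
  assumes "s \<le> e"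
  shows "(\<Sum>t=Suc s..e. of_bool (y t = i) - of_bool (y t = Suc i)) = excess y i s - excess y i e"
  using assms
proof (induction e rule: dec_induct)
  case (step e)
  then show ?case by (simp add: excess_def letter_count_def)
qed simp

text \<open>Raising the height at \<open>Suc i\<close> by 1 moves a path from row
  \<open>i + 1\<close> into row \<open>i\<close>, so it gains the letters \<open>i\<close> and loses
  the letters \<open>Suc i\<close>; \<open>d = -1\<close> moves it back.\<close>

lemma path_count_shift:
  "path_count n y (\<lambda>t q. F t q + of_bool (q = Suc i \<and> t \<in> A) * d) =
   path_count n y F + d * (\<Sum>t\<in>{1..n} \<inter> A. of_bool (y t = i) - of_bool (y t = Suc i))"
proof -
  have "path_count n y (\<lambda>t q. F t q + of_bool (q = Suc i \<and> t \<in> A) * d) =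
      (\<Sum>t=1..n. (F t (Suc (y t)) - F t (y t))
        + (if t \<in> A then d * (of_bool (y t = i) - of_bool (y t = Suc i)) else 0))"
    unfolding path_count_def by (intro sum.cong) (auto simp: algebra_simps)
  also have "\<dots> = path_count n y F + d * (\<Sum>t\<in>{1..n} \<inter> A. of_bool (y t = i) - of_bool (y t = Suc i))"
    unfolding sum.distrib path_count_def sum_distrib_left by (simp add: sum.inter_restrict)
  finally show ?thesis .
qed

text \<open>The correction is the occupation of row \<open>i\<close> at time \<open>v\<close> minus
  that of row \<open>i + 1\<close>; for a height path it is nonzero only if exactly one of them is
  occupied.\<close>

lemma path_count_upd:
  assumes "1 \<le> v" "v \<le> n" "y v = Suc i"
  shows "path_count n (y(v := i)) F =
    path_count n y F + (2 * F v (Suc i) - F v i - F v (Suc (Suc i)))"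
proof -
  have "path_count n z F = (F v (Suc (z v)) - F v (z v)) + (\<Sum>t\<in>{1..n} - {v}. F t (Suc (z t)) - F t (z t))" for z
    unfolding path_count_def using assms by (intro sum.remove) auto
  note this[of y] this[of "y(v := i)"]
  moreover have "(\<Sum>t\<in>{1..n} - {v}. F t (Suc ((y(v := i)) t)) - F t ((y(v := i)) t)) =
    (\<Sum>t\<in>{1..n} - {v}. F t (Suc (y t)) - F t (y t))"
    by (intro sum.cong) auto
  ultimately show ?thesis using assms by simp
qed

text \<open>The letter change hurts only if at time \<open>v\<close> a path sits in row
  \<open>i + 1\<close> while row \<open>i\<close> is free. Moving that path to row \<open>i\<close>
  from \<open>v\<close> to the end of this pattern changes the total, letter change included, by
  \<open>excess y i v - excess y i e\<close>, which is nonnegative by maximality.\<close>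

lemma raise_forward:
  assumes F: "height_path B j F" and i: "Suc i < B" and v: "1 \<le> v" "v \<le> n" "y v = Suc i"
    and mx: "\<And>t. t \<le> n \<Longrightarrow> excess y i t \<le> excess y i v"
  shows "\<exists>F'. height_path B j F' \<and> path_count n y F \<le> path_count n (y(v := i)) F'"
proof (cases "2 * F v (Suc i) - F v i - F v (Suc (Suc i)) \<ge> 0")
  case True
  then show ?thesis using F path_count_upd[of v n y i F, OF v] by auto
next
  case False
  define pat where "pat u \<longleftrightarrow> F u (Suc i) = F u i \<and> F u (Suc (Suc i)) = F u (Suc i) + 1" for u
  define A where "A = {t. v \<le> t \<and> (\<forall>u\<in>{v..t}. pat u)}"
  define F' where "F' = (\<lambda>t q. F t q + of_bool (q = Suc i \<and> t \<in> A) * (1::int))"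
  have st: "F t p \<le> F t (Suc p)" "F t (Suc p) \<le> F t p + 1" "F t q \<le> F (Suc t) q"
    if "p < B" "q \<le> B" for t p q using height_pathD[OF F] that by blast+
  have "pat v" using False st(1,2)[of i i v] st(1,2)[of "Suc i" i v] i unfolding pat_def by auto
  then have vA: "v \<in> A" by (auto simp: A_def)
  have patA: "pat t" if "t \<in> A" for t using that by (auto simp: A_def)
  \<comment> \<open>Heights only grow, so the pattern would persist if the height at
    \<open>Suc i\<close> stayed the same. When it ends, that height has risen by itself, and the
    rerouted heights stay monotone.\<close>
  have next_A: "F t (Suc i) + 1 \<le> F (Suc t) (Suc i)" if "t \<in> A" "Suc t \<notin> A" for t
  proof -
    have "\<not> pat (Suc t)" using that by (auto simp: A_def le_Suc_eq)
    then show ?thesis using patA[OF that(1)] i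
        st(1,2)[of i i "Suc t"] st(1,2)[of "Suc i" i "Suc t"] st(3)[of i i t] st(3)[of i "Suc (Suc i)" t]
      unfolding pat_def by auto
  qed
  have hp: "height_path B j F'"
    unfolding height_path_def
  proof (intro conjI allI impI)
    fix t show "F' t 0 = 0" "F' t B = int j" using F i by (auto simp: F'_def height_path_def)
  next
    fix t p assume p: "p < B"
    show "F' t p \<le> F' t (Suc p)" "F' t (Suc p) \<le> F' t p + 1"
      using st(1,2)[OF p, of i t] i patA[of t] by (auto simp: F'_def pat_def)
  next
    fix t p assume p: "p \<le> B"
    show "F' t p \<le> F' (Suc t) p"
      using st(3)[of i p t] p i next_A[of t] by (auto simp: F'_def)
  qed
  define e where "e = Max ({v..n} \<inter> A)"
  have ein: "e \<in> {v..n} \<inter> A" unfolding e_def using vA v by (intro Max_in) auto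
  have "{1..n} \<inter> A = {Suc (v - 1)..e}"
  proof -
    have "t \<le> e" if "t \<in> A" "t \<le> n" for t
      unfolding e_def using that by (intro Max_ge) (auto simp: A_def)
    moreover have "{v..e} \<subseteq> A" using ein by (auto simp: A_def)
    moreover have "A \<subseteq> {v..}" by (auto simp: A_def)
    ultimately show ?thesis using ein v by force
  qed
  then have "path_count n y F' = path_count n y F + (excess y i (v - 1) - excess y i e)"
    unfolding F'_def path_count_shift using excess_interval[of "v - 1" e y i] ein v by auto
  moreover have "excess y i v = excess y i (v - 1) + 1"
    using v by (cases v) (auto simp: excess_def letter_count_def)
  moreover have "excess y i e \<le> excess y i v" using mx ein by auto
  moreover have "2 * F' v (Suc i) - F' v i - F' v (Suc (Suc i)) = 1"
    using vA \<open>pat v\<close> by (auto simp: F'_def pat_def)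
  ultimately have "path_count n y F \<le> path_count n (y(v := i)) F'"
    using path_count_upd[of v n y i F', OF v] by linarith
  then show ?thesis using hp by blast
qed

text \<open>Now the harmful case is row \<open>i\<close> occupied and row \<open>i + 1\<close> free
  at \<open>v\<close>. The path is held back in row \<open>i + 1\<close> on the maximal stretch of
  this pattern ending at \<open>v\<close>. The gain \<open>excess y i v - excess y i (e - 1)\<close>
  is at least 1 because \<open>v\<close> is the first maximum, and this pays for the letter.\<close>

lemma raise_backward:
  assumes F: "height_path B j F" and i: "Suc i < B" and v: "1 \<le> v" "v \<le> n" "y v = Suc i"
    and mx: "\<And>t. t < v \<Longrightarrow> excess y i t < excess y i v"
  shows "\<exists>F'. height_path B j F' \<and> path_count n (y(v := i)) F \<le> path_count n y F'"
proof (cases "2 * F v (Suc i) - F v i - F v (Suc (Suc i)) \<le> 0")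
  case True
  then show ?thesis using F path_count_upd[of v n y i F, OF v] by auto
next
  case False
  define pat where "pat u \<longleftrightarrow> F u (Suc i) = F u i + 1 \<and> F u (Suc (Suc i)) = F u (Suc i)" for u
  define A where "A = {t. t \<le> v \<and> (\<forall>u\<in>{t..v}. pat u)}"
  define F' where "F' = (\<lambda>t q. F t q + of_bool (q = Suc i \<and> t \<in> A) * (-1::int))"
  have st: "F t p \<le> F t (Suc p)" "F t (Suc p) \<le> F t p + 1" "F t q \<le> F (Suc t) q"
    if "p < B" "q \<le> B" for t p q using height_pathD[OF F] that by blast+
  have "pat v" using False st(1,2)[of i i v] st(1,2)[of "Suc i" i v] i unfolding pat_def by auto
  then have vA: "v \<in> A" by (auto simp: A_def)
  have patA: "pat t" if "t \<in> A" for t using that by (auto simp: A_def)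
  have prev_A: "F t (Suc i) + 1 \<le> F (Suc t) (Suc i)" if "t \<notin> A" "Suc t \<in> A" for t
  proof -
    have "\<not> pat t"
    proof
      assume "pat t"
      then have "\<forall>u\<in>{t..v}. pat u" using that(2) unfolding A_def
        by (metis (mono_tags, lifting) atLeastAtMost_iff le_antisym mem_Collect_eq not_less_eq_eq)
      then show False using that by (auto simp: A_def)
    qed
    then show ?thesis using patA[OF that(2)] i
        st(1,2)[of i i t] st(1,2)[of "Suc i" i t] st(3)[of i i t] st(3)[of i "Suc (Suc i)" t]
      unfolding pat_def by auto
  qed
  have hp: "height_path B j F'"
    unfolding height_path_def
  proof (intro conjI allI impI)
    fix t show "F' t 0 = 0" "F' t B = int j" using F i by (auto simp: F'_def height_path_def)
  next
    fix t p assume p: "p < B"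
    show "F' t p \<le> F' t (Suc p)" "F' t (Suc p) \<le> F' t p + 1"
      using st(1,2)[OF p, of i t] i patA[of t] by (auto simp: F'_def pat_def)
  next
    fix t p assume p: "p \<le> B"
    show "F' t p \<le> F' (Suc t) p"
      using st(3)[of i p t] p i prev_A[of t] by (auto simp: F'_def)
  qed
  \<comment> \<open>Time 0 may belong to \<open>A\<close> but carries no letter.\<close>
  define e where "e = Min ({1..v} \<inter> A)"
  have ein: "e \<in> {1..v} \<inter> A" unfolding e_def using vA v by (intro Min_in) auto
  have "{1..n} \<inter> A = {Suc (e - 1)..v}"
  proof -
    have "e \<le> t" if "t \<in> A" "1 \<le> t" for t
      unfolding e_def using that by (intro Min_le) (auto simp: A_def)
    moreover have "{e..v} \<subseteq> A" using ein by (auto simp: A_def)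
    moreover have "A \<subseteq> {..v}" by (auto simp: A_def)
    ultimately show ?thesis using ein v by force
  qed
  then have "path_count n y F' = path_count n y F - (excess y i (e - 1) - excess y i v)"
    unfolding F'_def path_count_shift using excess_interval[of "e - 1" v y i] ein v by auto
  moreover have "excess y i (e - 1) < excess y i v" using mx ein by auto
  moreover have "2 * F v (Suc i) - F v i - F v (Suc (Suc i)) = 1"
    using \<open>pat v\<close> by (auto simp: pat_def)
  ultimately have "path_count n (y(v := i)) F \<le> path_count n y F'"
    using path_count_upd[of v n y i F, OF v] by linarith
  then show ?thesis using hp by blast
qed

lemma greene_raise:
  assumes "greene B n y j M" "Suc i < B" "1 \<le> v" "v \<le> n" "y v = Suc i"
    and "\<And>t. t \<le> n \<Longrightarrow> excess y i t \<le> excess y i v"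
    and "\<And>t. t < v \<Longrightarrow> excess y i t < excess y i v"
  shows "greene B n (y(v := i)) j M"
  using assms by (intro greene_transfer[OF assms(1)] raise_forward raise_backward) auto

section \<open>Jeu de taquin\<close>

definition cell_le :: "nat \<times> nat \<Rightarrow> nat \<times> nat \<Rightarrow> bool" (infix "\<sqsubseteq>" 50) where
  "c \<sqsubseteq> d \<longleftrightarrow> fst c \<le> fst d \<and> snd c \<le> snd d"

text \<open>Order convexity stands in for skew shapes: it survives filling a maximal hole and
  deleting a maximal cell, so no pair of partitions has to be carried along.\<close>

definition convex_cells :: "(nat \<times> nat) set \<Rightarrow> bool" where
  "convex_cells X \<longleftrightarrow> (\<forall>c d e. c \<in> X \<longrightarrow> d \<in> X \<longrightarrow> c \<sqsubseteq> e \<longrightarrow> e \<sqsubseteq> d \<longrightarrow> e \<in> X)"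

lemma cell_le_refl [simp]: "c \<sqsubseteq> c"
  and cell_le_trans: "c \<sqsubseteq> d \<Longrightarrow> d \<sqsubseteq> e \<Longrightarrow> c \<sqsubseteq> e"
  and cell_le_antisym: "c \<sqsubseteq> d \<Longrightarrow> d \<sqsubseteq> c \<Longrightarrow> c = d"
  and cell_le_Pair [simp]: "(i, j) \<sqsubseteq> (i', j') \<longleftrightarrow> i \<le> i' \<and> j \<le> j'"
  by (auto simp: cell_le_def prod_eq_iff)

lemma convex_cellsD: "convex_cells X \<Longrightarrow> c \<in> X \<Longrightarrow> d \<in> X \<Longrightarrow> c \<sqsubseteq> e \<Longrightarrow> e \<sqsubseteq> d \<Longrightarrow> e \<in> X"
  unfolding convex_cells_def by blast

text \<open>Increase is demanded along the product order, so that the entry next to a hole can be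
  compared with everything south-east of it. Values of \<open>y\<close> outside
  \<open>{1..n}\<close> are free.\<close>

definition tableau_word :: "nat \<Rightarrow> nat \<Rightarrow> tab \<Rightarrow> (nat \<Rightarrow> nat) \<Rightarrow> bool" where
  "tableau_word B n T y \<longleftrightarrow> ran T = {1..n}
     \<and> (\<forall>c d v. T c = Some v \<longrightarrow> T d = Some v \<longrightarrow> c = d)
     \<and> (\<forall>c v. T c = Some v \<longrightarrow> fst c < B \<and> y v = fst c)
     \<and> (\<forall>c d u v. T c = Some u \<longrightarrow> T d = Some v \<longrightarrow> c \<sqsubseteq> d \<longrightarrow> c \<noteq> d \<longrightarrow> u < v)"

lemma tableau_wordD:
  assumes "tableau_word B n T y"
  shows "ran T = {1..n}"
    and "T c = Some v \<Longrightarrow> T d = Some v \<Longrightarrow> c = d"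
    and "T c = Some v \<Longrightarrow> fst c < B"
    and "T c = Some v \<Longrightarrow> y v = fst c"
    and "T c = Some u \<Longrightarrow> T d = Some v \<Longrightarrow> c \<sqsubseteq> d \<Longrightarrow> c \<noteq> d \<Longrightarrow> u < v"
    and "T c = Some v \<Longrightarrow> 1 \<le> v" and "T c = Some v \<Longrightarrow> v \<le> n"
proof -
  show ran: "ran T = {1..n}"
    and "T c = Some v \<Longrightarrow> T d = Some v \<Longrightarrow> c = d"
    and "T c = Some v \<Longrightarrow> fst c < B"
    and "T c = Some v \<Longrightarrow> y v = fst c"
    and "T c = Some u \<Longrightarrow> T d = Some v \<Longrightarrow> c \<sqsubseteq> d \<Longrightarrow> c \<noteq> d \<Longrightarrow> u < v"
    using assms unfolding tableau_word_def by blast+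
  show "T c = Some v \<Longrightarrow> 1 \<le> v" and "T c = Some v \<Longrightarrow> v \<le> n"
    using ran ranI[of T c v] by auto
qed

lemma tableau_word_finite:
  assumes "tableau_word B n T y"
  shows "finite (dom T)"
proof (rule inj_on_finite)
  show "inj_on (\<lambda>c. the (T c)) (dom T)"
    using tableau_wordD(2)[OF assms] by (auto simp: inj_on_def)
  show "(\<lambda>c. the (T c)) ` dom T \<subseteq> {1..n}"
    using tableau_wordD(6,7)[OF assms] by auto
qed simp

section \<open>Rows of the entries up to a given time\<close>

definition row_upto :: "tab \<Rightarrow> nat \<Rightarrow> nat \<Rightarrow> nat set" where
  "row_upto T i t = {j. \<exists>v\<le>t. T (i, j) = Some v}"

lemma finite_row_upto:
  assumes "tableau_word B n T y"
  shows "finite (row_upto T i t)"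
proof -
  have "row_upto T i t \<subseteq> snd ` dom T" by (force simp: row_upto_def image_iff)
  then show ?thesis using tableau_word_finite[OF assms] finite_subset by blast
qed

lemma row_upto_mono: "s \<le> t \<Longrightarrow> row_upto T i s \<subseteq> row_upto T i t"
  by (auto simp: row_upto_def)

lemma letter_count_eq_card: "letter_count y i t = int (card {s\<in>{1..t}. y s = i})"
  by (simp add: letter_count_def Int_def flip: sum.inter_filter)

lemma letter_count_cells:
  assumes "tableau_word B n T y" "t \<le> n"
  shows "letter_count y i t = int (card (row_upto T i t))"
proof -
  note D = tableau_wordD[OF assms(1)]
  have "bij_betw (\<lambda>j. the (T (i, j))) (row_upto T i t) {s\<in>{1..t}. y s = i}"
  proof (rule bij_betw_imageI)
    show "inj_on (\<lambda>j. the (T (i, j))) (row_upto T i t)"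
      using D(2) by (fastforce simp: inj_on_def row_upto_def)
    show "(\<lambda>j. the (T (i, j))) ` row_upto T i t = {s\<in>{1..t}. y s = i}"
    proof (intro equalityI subsetI)
      fix s assume "s \<in> (\<lambda>j. the (T (i, j))) ` row_upto T i t"
      then show "s \<in> {s\<in>{1..t}. y s = i}" using D(4,6) by (force simp: row_upto_def)
    next
      fix s assume s: "s \<in> {s\<in>{1..t}. y s = i}"
      then have "s \<in> ran T" using D(1) assms(2) by auto
      then obtain c where c: "T c = Some s" by (auto simp: ran_def)
      with s D(4)[of c s] have "fst c = i" by auto
      then have "T (i, snd c) = Some s" using c by (metis prod.collapse)
      then show "s \<in> (\<lambda>j. the (T (i, j))) ` row_upto T i t"
        using s by (intro image_eqI[of _ _ "snd c"]) (auto simp: row_upto_def)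
    qed
  qed
  then show ?thesis unfolding letter_count_eq_card by (simp add: bij_betw_same_card)
qed

text \<open>The entry that a jeu de taquin slide moves up from row \<open>i + 1\<close> is the first one at which
  the excess of row \<open>i + 1\<close> over row \<open>i\<close> is maximal.\<close>

lemma excess_max_at_vertical_move:
  assumes tw: "tableau_word B n T y" and hole: "T (i, j) = None"
    and conv: "convex_cells (insert (i, j) (dom T))"
    and v: "T (Suc i, j) = Some v"
    and least: "\<And>z u. T z = Some u \<Longrightarrow> (i, j) \<sqsubseteq> z \<Longrightarrow> v \<le> u"
    and t: "t \<le> n"
  shows "excess y i t \<le> excess y i v" and "t < v \<Longrightarrow> excess y i t < excess y i v"
proof -
  note D = tableau_wordD[OF tw]
  define R where "R = row_upto T"
  have fin: "finite (R p s)" for p s unfolding R_def by (rule finite_row_upto[OF tw])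
  have lc: "letter_count y p s = int (card (R p s))" if "s \<le> n" for p s
    unfolding R_def by (rule letter_count_cells[OF tw that])
  have vn: "v \<le> n" using D(7)[OF v] .
  have diff: "letter_count y p s' = letter_count y p s + int (card (R p s' - R p s))"
    if "s \<le> s'" "s' \<le> n" for p s s'
  proof -
    have "R p s \<subseteq> R p s'" unfolding R_def using that row_upto_mono by blast
    then have "card (R p s') = card (R p s) + card (R p s' - R p s)"
      using fin by (metis Diff_partition card_Diff_subset card_mono finite_subset le_add_diff_inverse)
    then show ?thesis using lc that by simp
  qed
  \<comment> \<open>Entries of row \<open>i + 1\<close> in the window after \<open>v\<close> lie
    right of column \<open>j\<close>, and the entries above them fall into the same window; columns
    thus embed one set into the other.\<close>
  have after: "excess y i t \<le> excess y i v" if "v \<le> t"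
  proof -
    have "R (Suc i) t - R (Suc i) v \<subseteq> R i t - R i v"
    proof
      fix q assume "q \<in> R (Suc i) t - R (Suc i) v"
      then obtain u where u: "T (Suc i, q) = Some u" "u \<le> t" "v < u"
        by (auto simp: R_def row_upto_def not_le)
      have q: "j < q"
      proof (rule ccontr)
        assume "\<not> j < q"
        then have "q = j \<or> u < v" using D(5)[OF u(1) v] by auto
        then show False using u v by auto
      qed
      have "(i, q) \<in> insert (i, j) (dom T)"
        by (rule convex_cellsD[OF conv, of "(i, j)" "(Suc i, q)"]) (use q u in auto)
      then obtain u' where u': "T (i, q) = Some u'" using q by auto
      have "u' < u" using D(5)[OF u' u(1)] by auto
      moreover have "v \<le> u'" using least[OF u'] q by auto
      moreover have "v \<noteq> u'" using D(2)[OF v, of "(i, q)"] u' by auto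
      ultimately show "q \<in> R i t - R i v" using u u' by (auto simp: R_def row_upto_def)
    qed
    then have "card (R (Suc i) t - R (Suc i) v) \<le> card (R i t - R i v)"
      using fin by (intro card_mono) auto
    then show ?thesis using diff[OF that t] unfolding excess_def by simp
  qed
  \<comment> \<open>Before \<open>v\<close> the roles are reversed: entries of row \<open>i\<close>
    lie left of the hole, and those below them are still smaller than \<open>v\<close>. Column
    \<open>j\<close> occurs only in row \<open>i + 1\<close>, hence strictness.\<close>
  have before: "excess y i t < excess y i v" if "t < v"
  proof -
    have "R i v - R i t \<subset> R (Suc i) v - R (Suc i) t"
    proof
      show "R i v - R i t \<subseteq> R (Suc i) v - R (Suc i) t"
      proof
        fix q assume "q \<in> R i v - R i t"
        then obtain u where u: "T (i, q) = Some u" "u \<le> v" "t < u"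
          by (auto simp: R_def row_upto_def not_le)
        have "u \<noteq> v" using D(2)[OF v, of "(i, q)"] u by auto
        then have "\<not> j \<le> q" using least[OF u(1)] u by auto
        then have q: "q < j" by simp
        have "(Suc i, q) \<in> insert (i, j) (dom T)"
          by (rule convex_cellsD[OF conv, of "(i, q)" "(Suc i, j)"]) (use q u v in auto)
        then obtain u' where u': "T (Suc i, q) = Some u'" by auto
        have "u < u'" using D(5)[OF u(1) u'] by auto
        moreover have "u' < v" using D(5)[OF u' v] q by auto
        ultimately show "q \<in> R (Suc i) v - R (Suc i) t" using u u' by (auto simp: R_def row_upto_def)
      qed
      have "j \<in> R (Suc i) v - R (Suc i) t" using v that by (auto simp: R_def row_upto_def)
      moreover have "j \<notin> R i v - R i t" using hole by (auto simp: R_def row_upto_def)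
      ultimately show "R i v - R i t \<noteq> R (Suc i) v - R (Suc i) t" by blast
    qed
    then have "card (R i v - R i t) < card (R (Suc i) v - R (Suc i) t)"
      using fin by (intro psubset_card_mono) auto
    then show ?thesis using diff[OF less_imp_le[OF that] vn] unfolding excess_def by simp
  qed
  show "t < v \<Longrightarrow> excess y i t < excess y i v" by (rule before)
  show "excess y i t \<le> excess y i v" using after before by (cases "v \<le> t") auto
qed

section \<open>Invariance of the path maxima under slides\<close>

definition greene_preserving :: "nat \<Rightarrow> nat \<Rightarrow> (nat \<Rightarrow> nat) \<Rightarrow> (nat \<Rightarrow> nat) \<Rightarrow> bool" where
  "greene_preserving B n y y' \<longleftrightarrow> (\<forall>j M. greene B n y j M \<longrightarrow> greene B n y' j M)"

text \<open>A horizontal move keeps each entry in its row and hence the word; a vertical move is the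
  letter change of \<open>greene_raise\<close>, at the time located by
  \<open>excess_max_at_vertical_move\<close>. The hypothesis \<open>least\<close> also keeps the
  entries increasing.\<close>

lemma jdt_move:
  assumes tw: "tableau_word B n T y" and hole: "T c = None"
    and conv: "convex_cells (insert c (dom T))"
    and v: "T d = Some v" and d: "d = (fst c, Suc (snd c)) \<or> d = (Suc (fst c), snd c)"
    and least: "\<And>z u. T z = Some u \<Longrightarrow> c \<sqsubseteq> z \<Longrightarrow> v \<le> u"
  shows "tableau_word B n (T(c := T d, d := None)) (y(v := fst c))"
    and "greene_preserving B n y (y(v := fst c))"
proof -
  note D = tableau_wordD[OF tw]
  have cd: "c \<noteq> d" "c \<sqsubseteq> d" using d by (auto simp: cell_le_def prod_eq_iff)
  define T' where "T' = T(c := T d, d := None)"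
  have T'I: "T' z = Some u \<longleftrightarrow> (if z = c then u = v else z \<noteq> d \<and> T z = Some u)" for z u
    using cd v by (auto simp: T'_def)
  have val: "u \<noteq> v" if "T z = Some u" "z \<noteq> d" for z u using D(2)[OF v, of z] that by auto
  show "tableau_word B n (T(c := T d, d := None)) (y(v := fst c))"
    unfolding tableau_word_def T'_def[symmetric]
  proof (intro conjI allI impI)
    have "ran T' = ran T"
    proof (intro equalityI subsetI)
      fix u assume "u \<in> ran T'"
      then show "u \<in> ran T" using ranI[of T d, OF v] by (auto simp: ran_def T'I split: if_splits)
    next
      fix u assume "u \<in> ran T"
      then obtain z where z: "T z = Some u" by (auto simp: ran_def)
      have "T' (if z = d then c else z) = Some u" using z v hole by (auto simp: T'I)
      then show "u \<in> ran T'" by (rule ranI)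
    qed
    then show "ran T' = {1..n}" using D(1) by simp
    show "z = z'" if "T' z = Some u" "T' z' = Some u" for z z' u
      using that val[of z u] val[of z' u] D(2)[of z u z'] by (auto simp: T'I split: if_splits)
    show "fst z < B" if "T' z = Some u" for z u
      using that D(3)[OF v] D(3)[of z u] d by (auto simp: T'I split: if_splits)
    show "(y(v := fst c)) u = fst z" if "T' z = Some u" for z u
      using that D(4)[of z u] val[of z u] by (auto simp: T'I split: if_splits)
    show "u < u'" if "T' z = Some u" "T' z' = Some u'" "z \<sqsubseteq> z'" "z \<noteq> z'" for z z' u u'
    proof (cases "z = c")
      case True
      then have "u = v" "z' \<noteq> d" "T z' = Some u'" using that by (auto simp: T'I split: if_splits)
      then show ?thesis using least[of z' u'] val[of z' u'] that True by auto
    next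
      case False
      then have z: "T z = Some u" "z \<noteq> d" using that by (auto simp: T'I split: if_splits)
      show ?thesis
      proof (cases "z' = c")
        case True
        then show ?thesis using that z D(5)[OF z(1) v] cd cell_le_trans
          by (auto simp: T'I split: if_splits)
      next
        case False
        then show ?thesis using that z D(5)[OF z(1), of z' u'] by (auto simp: T'I split: if_splits)
      qed
    qed
  qed
  show "greene_preserving B n y (y(v := fst c))"
  proof (cases "d = (fst c, Suc (snd c))")
    case True
    then have "y(v := fst c) = y" using D(4)[OF v] by (auto simp: fun_eq_iff)
    then show ?thesis by (simp add: greene_preserving_def)
  next
    case False
    then have d': "d = (Suc (fst c), snd c)" using d by simp
    note ex = excess_max_at_vertical_move[of B n T y "fst c" "snd c" v, OF tw]
    have v': "T (Suc (fst c), snd c) = Some v" using v d' by simp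
    show ?thesis unfolding greene_preserving_def
    proof (intro allI impI)
      fix j M assume M: "greene B n y j M"
      show "greene B n (y(v := fst c)) j M"
      proof (rule greene_raise[OF M])
        show "Suc (fst c) < B" "1 \<le> v" "v \<le> n" "y v = Suc (fst c)"
          using D(3)[OF v] D(6)[OF v] D(7)[OF v] D(4)[OF v] d' by auto
        show "excess y (fst c) t \<le> excess y (fst c) v" if "t \<le> n" for t
          using ex(1)[OF _ _ v' _ that] hole conv least by simp
        show "excess y (fst c) t < excess y (fst c) v" if "t < v" for t
          using ex(2)[OF _ _ v' _ _ that] hole conv least D(7)[OF v] that by simp
      qed
    qed
  qed
qed

lemma greene_preserving_refl: "greene_preserving B n y y"
  and greene_preserving_trans:
    "greene_preserving B n y y' \<Longrightarrow> greene_preserving B n y' y'' \<Longrightarrow> greene_preserving B n y y''"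
  by (auto simp: greene_preserving_def)

text \<open>The union of the hole and the filled cells stays fixed; the hole wanders through it and
  stops at a maximal cell \<open>e\<close>. The fuel exceeds the number of filled cells south-east
  of the hole, which drops with every move.\<close>

lemma slide_aux_correct:
  assumes "tableau_word B n T y" "T c = None" "convex_cells (insert c (dom T))"
    and "card {z \<in> dom T. c \<sqsubseteq> z} < f"
  shows "\<exists>e y'. tableau_word B n (slide_aux f T c) y' \<and> greene_preserving B n y y'
    \<and> dom (slide_aux f T c) = insert c (dom T) - {e}
    \<and> e \<in> insert c (dom T) \<and> (\<forall>z\<in>insert c (dom T). e \<sqsubseteq> z \<longrightarrow> z = e)"
  using assms
proof (induction f arbitrary: T c y)
  case (Suc f)
  note tw = Suc.prems(1) and hole = Suc.prems(2) and conv = Suc.prems(3)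
  note D = tableau_wordD[OF tw]
  define X where "X = insert c (dom T)"
  obtain i j where c: "c = (i, j)" by (cases c)
  \<comment> \<open>By convexity a filled cell south-east of the hole lies beyond a filled neighbour
    of the hole, so the smaller neighbour is least among all of them.\<close>
  have above: "(\<exists>u. T (i, Suc j) = Some u \<and> (i, Suc j) \<sqsubseteq> z) \<or> (\<exists>u. T (Suc i, j) = Some u \<and> (Suc i, j) \<sqsubseteq> z)"
    if z: "T z = Some w" "c \<sqsubseteq> z" for z w
  proof -
    have "z \<noteq> c" using z hole by auto
    then have "(i, Suc j) \<sqsubseteq> z \<or> (Suc i, j) \<sqsubseteq> z" using z(2) unfolding c
      by (cases z) auto
    moreover have "x \<in> dom T" if "c \<sqsubseteq> x" "x \<noteq> c" "x \<sqsubseteq> z" for x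
      using convex_cellsD[OF conv, of c z x] that z by auto
    ultimately show ?thesis using c by (metis cell_le_Pair domD le_Suc_eq le_refl n_not_Suc_n old.prod.inject)
  qed
  have move: ?case
    if v: "T d = Some v" and d: "d = (i, Suc j) \<or> d = (Suc i, j)"
      and least: "\<And>z u. T z = Some u \<Longrightarrow> c \<sqsubseteq> z \<Longrightarrow> v \<le> u"
      and eq: "slide_aux (Suc f) T c = slide_aux f (T(c := T d, d := None)) d" for d v
  proof -
    let ?T = "T(c := T d, d := None)"
    have cd: "c \<noteq> d" "c \<sqsubseteq> d" using d c by auto
    have step: "tableau_word B n ?T (y(v := i))" "greene_preserving B n y (y(v := i))"
      using jdt_move[OF tw hole conv v _ least] d unfolding c by auto
    have X: "insert d (dom ?T) = X" using v cd unfolding X_def by auto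
    have "{z \<in> dom ?T. d \<sqsubseteq> z} \<subset> {z \<in> dom T. c \<sqsubseteq> z}"
    proof
      show "{z \<in> dom ?T. d \<sqsubseteq> z} \<subseteq> {z \<in> dom T. c \<sqsubseteq> z}"
        using cell_le_trans[OF cd(2)] cell_le_antisym[OF cd(2)] cd(1) by (auto split: if_splits)
      show "{z \<in> dom ?T. d \<sqsubseteq> z} \<noteq> {z \<in> dom T. c \<sqsubseteq> z}"
        using v cd by auto
    qed
    then have "card {z \<in> dom ?T. d \<sqsubseteq> z} < card {z \<in> dom T. c \<sqsubseteq> z}"
      using tableau_word_finite[OF tw] by (intro psubset_card_mono) auto
    then have less: "card {z \<in> dom ?T. d \<sqsubseteq> z} < f" using Suc.prems(4) by simp
    have "?T d = None" "convex_cells X"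
      using conv by (simp_all only: X_def fun_upd_same)
    from Suc.IH[OF step(1), of d, unfolded X, OF this less] obtain e y'
      where "tableau_word B n (slide_aux f ?T d) y'" "greene_preserving B n (y(v := i)) y'"
        "dom (slide_aux f ?T d) = X - {e}" "e \<in> X" "\<forall>z\<in>X. e \<sqsubseteq> z \<longrightarrow> z = e"
      by blast
    then show ?case unfolding eq X_def[symmetric] using greene_preserving_trans[OF step(2)] by blast
  qed
  show ?case
  proof (cases "T (i, Suc j)")
    case None
    show ?thesis
    proof (cases "T (Suc i, j)")
      case None
      have "slide_aux (Suc f) T c = T" using \<open>T (i, Suc j) = None\<close> None by (simp add: c)
      moreover have "z = c" if "z \<in> insert c (dom T)" "c \<sqsubseteq> z" for z
        using that above[of z] None \<open>T (i, Suc j) = None\<close> by auto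
      moreover have "dom T = insert c (dom T) - {c}" using hole by auto
      ultimately show ?thesis using tw greene_preserving_refl by (metis insertI1)
    next
      case (Some v)
      show ?thesis
      proof (rule move[OF Some])
        show "v \<le> u" if "T z = Some u" "c \<sqsubseteq> z" for z u
          using above[OF that] None Some D(5)[OF Some, of z u] that by (cases "z = (Suc i, j)") auto
      qed (use None Some in \<open>auto simp: c\<close>)
    qed
  next
    case (Some x)
    show ?thesis
    proof (cases "T (Suc i, j)")
      case None
      show ?thesis
      proof (rule move[OF Some])
        show "x \<le> u" if "T z = Some u" "c \<sqsubseteq> z" for z u
          using above[OF that] None Some D(5)[OF Some, of z u] that by (cases "z = (i, Suc j)") auto
      qed (use None Some in \<open>auto simp: c\<close>)
    next
      case (Some v)
      note x = \<open>T (i, Suc j) = Some x\<close>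
      have least: "x \<le> u \<or> v \<le> u" if "T z = Some u" "c \<sqsubseteq> z" for z u
        using above[OF that] D(5)[OF Some, of z u] D(5)[OF x, of z u] that x Some
        by (cases "z = (i, Suc j)"; cases "z = (Suc i, j)") auto
      show ?thesis
      proof (cases "x < v")
        case True
        show ?thesis
          by (rule move[OF x]) (use least True x Some in \<open>force simp: c\<close>)+
      next
        case False
        show ?thesis
          by (rule move[OF Some]) (use least False x Some in \<open>force simp: c\<close>)+
      qed
    qed
  qed
qed simp

section \<open>Holes and rectification\<close>

definition above_cells :: "(nat \<times> nat) set \<Rightarrow> (nat \<times> nat) set" where
  "above_cells X = {c. \<exists>d\<in>X. c \<sqsubseteq> d}"

lemma finite_above_cells: "finite X \<Longrightarrow> finite (above_cells X)"
proof -
  assume X: "finite X"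
  have "above_cells X = (\<Union>d\<in>X. {..fst d} \<times> {..snd d})"
    by (force simp: above_cells_def cell_le_def)
  then show ?thesis using X by simp
qed

lemma holes_eq: "holes T = above_cells (dom T) - dom T"
  by (auto simp: holes_def above_cells_def cell_le_def)

lemma lexmax_holes:
  assumes "finite H" "H \<noteq> {}"
  shows "lexmax H \<in> H" and "z \<in> H \<Longrightarrow> lexmax H \<sqsubseteq> z \<Longrightarrow> z = lexmax H"
proof -
  define i where "i = Max (fst ` H)"
  define J where "J = {j. (i, j) \<in> H}"
  have lm: "lexmax H = (i, Max J)" by (simp add: lexmax_def i_def J_def Let_def)
  have "i \<in> fst ` H" unfolding i_def using assms by (intro Max_in) auto
  then have J: "J \<noteq> {}" by (auto simp: J_def)
  have "J \<subseteq> snd ` H" by (force simp: J_def)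
  then have fJ: "finite J" using assms(1) finite_subset by blast
  have "Max J \<in> J" using J fJ by simp
  then show "lexmax H \<in> H" by (simp add: lm J_def)
  show "z = lexmax H" if "z \<in> H" "lexmax H \<sqsubseteq> z"
  proof -
    have "fst z \<le> i" unfolding i_def using assms that by (intro Max_ge) auto
    then have fz: "fst z = i" using that unfolding lm cell_le_def by simp
    then have "snd z \<in> J" using that by (auto simp: J_def)
    then have "snd z \<le> Max J" using fJ by simp
    then show ?thesis using fz that unfolding lm cell_le_def by (simp add: prod_eq_iff)
  qed
qed

text \<open>The chosen corner is a maximal hole, so filling it keeps convexity; the vacated cell is
  maximal, so deleting it keeps convexity and creates no hole. The two differ because a filled cell
  lies south-east of the corner, so a hole is lost for good.\<close>

lemma slide_correct:
  assumes tw: "tableau_word B n T y" and conv: "convex_cells (dom T)" and ne: "holes T \<noteq> {}"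
  shows "\<exists>y'. tableau_word B n (slide T (lexmax (holes T))) y' \<and> greene_preserving B n y y'
    \<and> convex_cells (dom (slide T (lexmax (holes T))))
    \<and> holes (slide T (lexmax (holes T))) \<subset> holes T"
proof -
  define c where "c = lexmax (holes T)"
  have finH: "finite (holes T)"
    unfolding holes_eq using tableau_word_finite[OF tw] finite_above_cells by auto
  have cH: "c \<in> holes T" and cmax: "\<And>z. z \<in> holes T \<Longrightarrow> c \<sqsubseteq> z \<Longrightarrow> z = c"
    unfolding c_def using lexmax_holes[OF finH ne] by auto
  define X where "X = insert c (dom T)"
  have hole: "T c = None" using cH by (auto simp: holes_eq)
  obtain d0 where d0: "d0 \<in> dom T" "c \<sqsubseteq> d0" using cH by (auto simp: holes_eq above_cells_def)
  have convX: "convex_cells X"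
    unfolding convex_cells_def
  proof (intro allI impI)
    fix p q x assume pq: "p \<in> X" "q \<in> X" "p \<sqsubseteq> x" "x \<sqsubseteq> q"
    obtain q' where q': "q' \<in> dom T" "x \<sqsubseteq> q'"
      using pq d0 cell_le_trans unfolding X_def by blast
    show "x \<in> X"
    proof (cases "p = c")
      case True
      then show ?thesis using cmax[of x] pq q' unfolding X_def holes_eq above_cells_def by auto
    next
      case False
      then have "x \<in> dom T" using convex_cellsD[OF conv _ q'(1) pq(3) q'(2)] pq(1) by (simp add: X_def)
      then show ?thesis by (simp add: X_def)
    qed
  qed
  have "card {z \<in> dom T. c \<sqsubseteq> z} \<le> card (dom T)"
    using tableau_word_finite[OF tw] by (intro card_mono) auto
  then have "card {z \<in> dom T. c \<sqsubseteq> z} < Suc (card (dom T))" by simp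
  from slide_aux_correct[OF tw hole convX[unfolded X_def] this] obtain e y'
    where r: "tableau_word B n (slide T c) y'" "greene_preserving B n y y'"
      "dom (slide T c) = X - {e}" "e \<in> X" and emax: "\<And>z. z \<in> X \<Longrightarrow> e \<sqsubseteq> z \<Longrightarrow> z = e"
    unfolding slide_def[symmetric] X_def[symmetric] by blast
  have ec: "e \<noteq> c" using emax[of d0] d0 hole by (auto simp: X_def)
  have conv': "convex_cells (X - {e})"
    unfolding convex_cells_def
  proof (intro allI impI)
    fix p q x assume pq: "p \<in> X - {e}" "q \<in> X - {e}" "p \<sqsubseteq> x" "x \<sqsubseteq> q"
    then have "x \<in> X" using convex_cellsD[OF convX] by blast
    moreover have "x \<noteq> e" using emax[of q] pq by auto
    ultimately show "x \<in> X - {e}" by simp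
  qed
  have "holes (slide T c) \<subseteq> holes T - {c}"
  proof
    fix x assume "x \<in> holes (slide T c)"
    then obtain d where d: "x \<notin> X - {e}" "d \<in> X - {e}" "x \<sqsubseteq> d"
      unfolding holes_eq above_cells_def r(3) by auto
    have xX: "x \<notin> X" using d emax[of d] by auto
    obtain d' where "d' \<in> dom T" "x \<sqsubseteq> d'" using d d0 cell_le_trans unfolding X_def by blast
    then show "x \<in> holes T - {c}" using xX unfolding holes_eq above_cells_def X_def by auto
  qed
  then have "holes (slide T c) \<subset> holes T" using cH by blast
  then show ?thesis unfolding c_def[symmetric] using r conv' by auto
qed

lemma rect_aux_correct:
  assumes "tableau_word B n T y" "convex_cells (dom T)" "card (holes T) \<le> f"
  shows "\<exists>y'. tableau_word B n (rect_aux f T) y' \<and> greene_preserving B n y y' \<and> holes (rect_aux f T) = {}"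
  using assms
proof (induction f arbitrary: T y)
  case 0
  have "finite (holes T)"
    unfolding holes_eq using tableau_word_finite[OF 0(1)] finite_above_cells by auto
  then show ?case using 0 greene_preserving_refl by auto
next
  case (Suc f)
  show ?case
  proof (cases "holes T = {}")
    case True
    then show ?thesis using Suc.prems greene_preserving_refl by auto
  next
    case False
    define T' where "T' = slide T (lexmax (holes T))"
    obtain y1 where y1: "tableau_word B n T' y1" "greene_preserving B n y y1"
      "convex_cells (dom T')" "holes T' \<subset> holes T"
      using slide_correct[OF Suc.prems(1,2) False] unfolding T'_def by blast
    have "finite (holes T)"
      unfolding holes_eq using tableau_word_finite[OF Suc.prems(1)] finite_above_cells by auto
    then have "card (holes T') \<le> f" using psubset_card_mono[OF _ y1(4)] Suc.prems(3) by simp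
    from Suc.IH[OF y1(1,3) this] show ?thesis
      using False greene_preserving_trans[OF y1(2)] unfolding T'_def by auto
  qed
qed

section \<open>Straight shapes\<close>

lemma sum_by_parts_int:
  fixes a X :: "nat \<Rightarrow> int"
  shows "(\<Sum>i<Suc m. a i * (X (Suc i) - X i)) + (\<Sum>i<m. X (Suc i) * (a (Suc i) - a i))
    = a m * X (Suc m) - a 0 * X 0"
  by (induction m) (simp_all add: algebra_simps)

lemma letter_count_0 [simp]: "letter_count y i 0 = 0"
  and letter_count_Suc [simp]: "letter_count y i (Suc t) = letter_count y i t + of_bool (y (Suc t) = i)"
  by (simp_all add: letter_count_def)

text \<open>The first sum is the yield of paths standing still in their final rows. A path that
  passes from row \<open>i + 1\<close> to row \<open>i\<close> between \<open>t\<close> and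
  \<open>t + 1\<close> was offered letters \<open>i + 1\<close> instead of \<open>i\<close> up to
  time \<open>t\<close>, an advantage of \<open>excess y i t\<close>.\<close>

lemma path_count_by_parts:
  assumes F: "height_path B j F" and y: "\<And>t. 1 \<le> t \<Longrightarrow> t \<le> n \<Longrightarrow> y t < B" and B: "B \<ge> 1"
  shows "path_count n y F = (\<Sum>i<B. letter_count y i n * (F n (Suc i) - F n i))
    + (\<Sum>t<n. \<Sum>i<B - 1. (F (Suc t) (Suc i) - F t (Suc i)) * excess y i t)"
  using y
proof (induction n)
  case 0
  then show ?case by (simp add: path_count_def)
next
  case (Suc n)
  obtain m where m: "B = Suc m" using B by (cases B) auto
  define X where "X p = F (Suc n) p - F n p" for p
  have X0: "X 0 = 0" "X B = 0" using height_pathD(1,2)[OF F] by (auto simp: X_def)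
  let ?a = "\<lambda>i. letter_count y i n"
  have "(\<Sum>i<B. letter_count y i (Suc n) * (F (Suc n) (Suc i) - F (Suc n) i)) =
      (\<Sum>i<B. ?a i * (F n (Suc i) - F n i) + ?a i * (X (Suc i) - X i)
        + (if i = y (Suc n) then F (Suc n) (Suc i) - F (Suc n) i else 0))"
    by (intro sum.cong refl) (simp add: X_def algebra_simps)
  also have "\<dots> = (\<Sum>i<B. ?a i * (F n (Suc i) - F n i)) + (\<Sum>i<B. ?a i * (X (Suc i) - X i))
      + (F (Suc n) (Suc (y (Suc n))) - F (Suc n) (y (Suc n)))"
    using Suc.prems[of "Suc n"] by (simp add: sum.distrib)
  finally have "(\<Sum>i<B. letter_count y i (Suc n) * (F (Suc n) (Suc i) - F (Suc n) i)) =
      (\<Sum>i<B. ?a i * (F n (Suc i) - F n i)) + (\<Sum>i<B. ?a i * (X (Suc i) - X i))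
      + (F (Suc n) (Suc (y (Suc n))) - F (Suc n) (y (Suc n)))" .
  moreover have "(\<Sum>i<B. ?a i * (X (Suc i) - X i)) + (\<Sum>i<B - 1. X (Suc i) * excess y i n) = 0"
    using sum_by_parts_int[of ?a X m] X0 by (simp add: m excess_def)
  moreover have "path_count (Suc n) y F = path_count n y F
      + (F (Suc n) (Suc (y (Suc n))) - F (Suc n) (y (Suc n)))"
    by (simp add: path_count_def)
  moreover have "path_count n y F = (\<Sum>i<B. ?a i * (F n (Suc i) - F n i))
    + (\<Sum>t<n. \<Sum>i<B - 1. (F (Suc t) (Suc i) - F t (Suc i)) * excess y i t)"
    using Suc by simp
  ultimately show ?case unfolding sum.lessThan_Suc X_def by linarith
qed

lemma sum_top_le:
  fixes a f :: "nat \<Rightarrow> int"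
  assumes anti: "\<And>i. Suc i < B \<Longrightarrow> a (Suc i) \<le> a i"
    and f: "\<And>i. i < B \<Longrightarrow> 0 \<le> f i \<and> f i \<le> 1" and tot: "(\<Sum>i<B. f i) = int j" and j: "j \<le> B"
  shows "(\<Sum>i<B. a i * f i) \<le> (\<Sum>i<j. a i)"
proof (cases j)
  case 0
  then have "f i = 0" if "i < B" for i
    using tot f sum_nonneg_eq_0_iff[of "{..<B}" f] that by auto
  then show ?thesis using 0 by simp
next
  case (Suc q)
  have mono: "a i' \<le> a i" if "i \<le> i'" "i' < B" for i i'
    using that
  proof (induction i' rule: dec_induct)
    case (step n)
    then show ?case using anti[of n] by simp
  qed simp
  define h :: "nat \<Rightarrow> int" where "h i = of_bool (i < j)" for i
  \<comment> \<open>In each term the factors have opposite signs around the last chosen weight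
    \<open>a q\<close>. Subtracting \<open>a q\<close> is free since \<open>f\<close> and
    \<open>h\<close> have the same total \<open>j\<close>.\<close>
  have "(\<Sum>i<B. (a i - a q) * (f i - h i)) \<le> 0"
    unfolding h_def
  proof (rule sum_nonpos)
    fix i assume i: "i \<in> {..<B}"
    show "(a i - a q) * (f i - of_bool (i < j)) \<le> 0"
    proof (cases "i < j")
      case True
      then have "a q \<le> a i" using mono[of i q] Suc j by simp
      then show ?thesis using True f[of i] i by (intro mult_nonneg_nonpos) auto
    next
      case False
      then have "a i \<le> a q" using mono[of q i] Suc i by simp
      then show ?thesis using False f[of i] i by (intro mult_nonpos_nonneg) auto
    qed
  qed
  moreover have "(\<Sum>i<B. h i * g i) = (\<Sum>i<j. g i)" for g :: "nat \<Rightarrow> int"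
    unfolding h_def using j by (subst sum.mono_neutral_right[of _ "{..<j}"]) auto
  note this[of a] this[of "\<lambda>_. 1"]
  moreover have "(\<Sum>i<B. (a i - a q) * (f i - h i)) =
    (\<Sum>i<B. a i * f i) - a q * (\<Sum>i<B. f i) - (\<Sum>i<B. h i * a i) + a q * (\<Sum>i<B. h i * 1)"
    by (simp add: sum_distrib_left algebra_simps flip: sum.distrib sum_subtractf)
  ultimately show ?thesis using tot by simp
qed

text \<open>If no excess is positive, no crossing pays, and standing still in the first
  \<open>j\<close> rows is best.\<close>

lemma greene_dominant:
  assumes y: "\<And>t. 1 \<le> t \<Longrightarrow> t \<le> n \<Longrightarrow> y t < B" and B: "B \<ge> 1" and j: "j \<le> B"
    and dom: "\<And>i t. Suc i < B \<Longrightarrow> t \<le> n \<Longrightarrow> excess y i t \<le> 0"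
  shows "greene B n y j (\<Sum>i<j. letter_count y i n)"
  unfolding greene_def
proof (intro conjI allI impI)
  define F where "F = (\<lambda>(t::nat) p. int (min p j))"
  have F: "height_path B j F" using j by (auto simp: height_path_def F_def)
  have "path_count n y F = (\<Sum>i<B. letter_count y i n * (F n (Suc i) - F n i))"
    using path_count_by_parts[OF F y B] by (simp add: F_def)
  also have "\<dots> = (\<Sum>i<j. letter_count y i n)"
    using j by (intro sum.mono_neutral_cong_right) (auto simp: F_def min_def)
  finally show "\<exists>F. height_path B j F \<and> path_count n y F = (\<Sum>i<j. letter_count y i n)"
    using F by blast
next
  fix F assume F: "height_path B j F"
  have "path_count n y F \<le> (\<Sum>i<B. letter_count y i n * (F n (Suc i) - F n i))"
  proof -
    have "(\<Sum>t<n. \<Sum>i<B - 1. (F (Suc t) (Suc i) - F t (Suc i)) * excess y i t) \<le> 0"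
      using height_pathD(5)[OF F] dom by (intro sum_nonpos mult_nonneg_nonpos) auto
    then show ?thesis using path_count_by_parts[OF F y B] by simp
  qed
  also have "\<dots> \<le> (\<Sum>i<j. letter_count y i n)"
  proof (rule sum_top_le[OF _ _ _ j])
    show "letter_count y (Suc i) n \<le> letter_count y i n" if "Suc i < B" for i
      using dom[OF that, of n] by (simp add: excess_def)
    show "0 \<le> F n (Suc i) - F n i \<and> F n (Suc i) - F n i \<le> 1" if "i < B" for i
      using height_pathD(3,4)[OF F that, of n] by linarith
    show "(\<Sum>i<B. F n (Suc i) - F n i) = int j"
      using height_pathD(1,2)[OF F] by (simp add: sum_lessThan_telescope)
  qed
  finally show "path_count n y F \<le> (\<Sum>i<j. letter_count y i n)" .
qed

text \<open>The entries up to \<open>t\<close> again form a straight shape, so each row of them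
  covers the columns of the next and no excess is positive.\<close>

lemma straight_tableau:
  assumes tw: "tableau_word B n T y" and holes: "holes T = {}" and B: "B \<ge> 1"
  shows "j \<le> B \<Longrightarrow> greene B n y j (\<Sum>i<j. letter_count y i n)"
    and "dom T = {(i, j). i < B \<and> int j < letter_count y i n}"
proof -
  note D = tableau_wordD[OF tw]
  have down: "c \<in> dom T" if "c \<sqsubseteq> d" "d \<in> dom T" for c d
    using holes that unfolding holes_eq above_cells_def by auto
  have sub: "row_upto T (Suc i) t \<subseteq> row_upto T i t" for i t
  proof
    fix q assume "q \<in> row_upto T (Suc i) t"
    then obtain v where v: "T (Suc i, q) = Some v" "v \<le> t" by (auto simp: row_upto_def)
    then obtain u where u: "T (i, q) = Some u" using down[of "(i, q)" "(Suc i, q)"] by auto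
    then show "q \<in> row_upto T i t" using D(5)[OF u v(1)] v by (auto simp: row_upto_def)
  qed
  have ex: "excess y i t \<le> 0" if "t \<le> n" for i t
    using letter_count_cells[OF tw that] card_mono[OF finite_row_upto[OF tw] sub]
    by (simp add: excess_def)
  have yB: "y t < B" if "1 \<le> t" "t \<le> n" for t
  proof -
    have "t \<in> ran T" using D(1) that by auto
    then obtain c where "T c = Some t" by (auto simp: ran_def)
    then show ?thesis using D(3,4)[of c t] by simp
  qed
  show "greene B n y j (\<Sum>i<j. letter_count y i n)" if "j \<le> B"
    by (rule greene_dominant[OF yB B that ex])
  have row: "(i, q) \<in> dom T \<longleftrightarrow> int q < letter_count y i n" for i q
  proof -
    define R where "R = row_upto T i n"
    have R: "q \<in> R \<longleftrightarrow> (i, q) \<in> dom T" for q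
      using D(7) by (auto simp: R_def row_upto_def)
    have dn: "q' \<in> R" if "q \<in> R" "q' \<le> q" for q q'
      using that down[of "(i, q')" "(i, q)"] R by auto
    have fin: "finite R" unfolding R_def by (rule finite_row_upto[OF tw])
    have "R = {..<card R}"
    proof (cases "R = {}")
      case False
      have "R = {..Max R}"
      proof
        show "R \<subseteq> {..Max R}" using fin by auto
        show "{..Max R} \<subseteq> R" using dn[OF Max_in[OF fin False]] by blast
      qed
      then have "R = {..<Suc (Max R)}" by (simp add: lessThan_Suc_atMost)
      then show ?thesis by (metis card_lessThan)
    qed simp
    then have "q \<in> R \<longleftrightarrow> q < card R" by blast
    then show ?thesis using R letter_count_cells[OF tw order.refl, of i] by (simp add: R_def)
  qed
  have "i < B" if "(i, q) \<in> dom T" for i q using that D(3)[of "(i, q)"] by auto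
  then show "dom T = {(i, j). i < B \<and> int j < letter_count y i n}"
    using row by blast
qed

section \<open>Periodic words\<close>

lemma height_path_bounds:
  assumes F: "height_path B j F" and p: "p \<le> B"
  shows "0 \<le> F t p" "F t p \<le> int j" "int j \<le> F t p + int (B - p)"
proof -
  show "0 \<le> F t p" using p
  proof (induction p)
    case (Suc p)
    then show ?case using height_pathD(3)[OF F, of p t] by simp
  qed (simp add: height_pathD(1)[OF F])
  have "F t p \<le> F t B \<and> F t B \<le> F t p + int (B - p)" using p
  proof (induction p rule: inc_induct)
    case (step p)
    then show ?case using height_pathD(3,4)[OF F, of p t] by auto
  qed simp
  then show "F t p \<le> int j" "int j \<le> F t p + int (B - p)"
    using height_pathD(2)[OF F, of t] by auto
qed

lemma letter_count_periodic:
  assumes "\<And>t. 1 \<le> t \<Longrightarrow> y (t + m) = y t"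
  shows "letter_count y i (t + m) = letter_count y i t + letter_count y i m"
proof (induction t)
  case (Suc t)
  then show ?case using assms[of "Suc t"] letter_count_Suc[of y i "t + m"] by simp
qed simp

lemma sum_lessThan_add_zero:
  fixes g :: "nat \<Rightarrow> int"
  assumes "\<And>i. i < a \<Longrightarrow> g i = 0"
  shows "(\<Sum>i<a + c. g i) = (\<Sum>q<c. g (a + q))"
  using assms by (induction c) auto

text \<open>The letters start at \<open>a\<close> since rows above the skew tableau may be empty.
  Equal content of all letters in a period makes every excess periodic.\<close>

locale periodic_word =
  fixes y :: "nat \<Rightarrow> nat" and a b r m :: nat
  assumes letters: "1 \<le> t \<Longrightarrow> a \<le> y t \<and> y t < a + b"
    and period: "1 \<le> t \<Longrightarrow> y (t + m) = y t"
    and content: "a \<le> i \<Longrightarrow> i < a + b \<Longrightarrow> letter_count y i m = int r"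
    and b: "b \<ge> 1" and m: "m \<ge> 1"
begin

definition max_excess :: "nat \<Rightarrow> int" where
  "max_excess i = Max (excess y i ` {..m})"

lemma letter_count_mult: "letter_count y i (q * m + t) = int q * letter_count y i m + letter_count y i t"
proof (induction q)
  case (Suc q)
  then show ?case using letter_count_periodic[of y m i "q * m + t"] period by (simp add: algebra_simps)
qed simp

lemma excess_mult:
  assumes "a \<le> i" "Suc i < a + b"
  shows "excess y i (q * m + t) = excess y i t"
  using assms by (simp add: excess_def letter_count_mult content)

lemma excess_le_max:
  assumes "a \<le> i" "Suc i < a + b"
  shows "excess y i t \<le> max_excess i"
proof -
  have "excess y i t = excess y i (t mod m)"
    using excess_mult[OF assms, of "t div m" "t mod m"] by (simp add: div_mult_mod_eq)
  also have "\<dots> \<le> max_excess i"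
    unfolding max_excess_def using m by (intro Max_ge) (auto intro!: imageI less_imp_le mod_less_divisor)
  finally show ?thesis .
qed

lemma excess_0 [simp]: "excess y i 0 = 0"
  by (simp add: excess_def)

text \<open>The excess at \<open>m\<close> equals that at 0, so \<open>t < m\<close> can be had; the
  strict bound is what orders crossings in consecutive periods.\<close>

lemma max_excess_attained:
  assumes "a \<le> i" "Suc i < a + b"
  shows "\<exists>t<m. excess y i t = max_excess i"
proof -
  have "max_excess i \<in> excess y i ` {..m}" unfolding max_excess_def by (intro Max_in) auto
  then obtain t where t: "t \<le> m" "excess y i t = max_excess i" by auto
  show ?thesis
  proof (cases "t = m")
    case True
    then have "excess y i 0 = max_excess i" using excess_mult[OF assms, of 1 0] t by simp
    then show ?thesis using m by (intro exI[of _ 0]) auto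
  next
    case False
    then show ?thesis using t by (intro exI[of _ t]) auto
  qed
qed

text \<open>Each row from \<open>a\<close> on holds \<open>k * r\<close> letters, so for paths
  avoiding the empty rows the stationary part does not depend on where they end.\<close>

lemma path_count_clamped:
  assumes F: "height_path (a + b) j F" and z: "\<And>t p. p \<le> a \<Longrightarrow> F t p = 0"
  shows "path_count (k * m) y F = int (j * k * r) + (\<Sum>q<b - 1. \<Sum>t<k * m.
    (F (Suc t) (Suc (a + q)) - F t (Suc (a + q))) * excess y (a + q) t)"
proof -
  let ?n = "k * m"
  have "(\<Sum>i<a + b. letter_count y i ?n * (F ?n (Suc i) - F ?n i))
      = (\<Sum>i<a + b. int (k * r) * (F ?n (Suc i) - F ?n i))"
  proof (intro sum.cong refl)
    fix i assume i: "i \<in> {..<a + b}"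
    show "letter_count y i ?n * (F ?n (Suc i) - F ?n i) = int (k * r) * (F ?n (Suc i) - F ?n i)"
    proof (cases "i < a")
      case True then show ?thesis using z by simp
    next
      case False then show ?thesis using letter_count_mult[of i k 0] content[of i] i by simp
    qed
  qed
  also have "\<dots> = int (k * r) * (F ?n (a + b) - F ?n 0)"
    by (simp only: sum_lessThan_telescope flip: sum_distrib_left)
  also have "\<dots> = int (j * k * r)" by (simp add: height_pathD(1,2)[OF F])
  finally have 1: "(\<Sum>i<a + b. letter_count y i ?n * (F ?n (Suc i) - F ?n i)) = int (j * k * r)" .
  have "(\<Sum>t<?n. \<Sum>i<a + b - 1. (F (Suc t) (Suc i) - F t (Suc i)) * excess y i t)
    = (\<Sum>i<a + (b - 1). \<Sum>t<?n. (F (Suc t) (Suc i) - F t (Suc i)) * excess y i t)"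
    using b by (subst sum.swap) simp
  also have "\<dots> = (\<Sum>q<b - 1. \<Sum>t<?n. (F (Suc t) (Suc (a + q)) - F t (Suc (a + q))) * excess y (a + q) t)"
    by (intro sum_lessThan_add_zero) (simp add: z)
  finally show ?thesis using path_count_by_parts[OF F, of ?n y] letters b 1 by simp
qed

text \<open>At the boundary \<open>p = q + 1\<close>, counted from row \<open>a\<close>, at most
  \<open>min p j\<close> paths are before it at the end and at least
  \<open>max 0 (j + p - b)\<close> at the start. The difference bounds the number of crossings, each
  worth at most \<open>max_excess (a + q)\<close>.\<close>

definition greene_bound :: "nat \<Rightarrow> nat \<Rightarrow> int" where
  "greene_bound j k = int (j * k * r)
     + (\<Sum>q<b - 1. max_excess (a + q) * (min (int q + 1) (int j) - max 0 (int j + int q + 1 - int b)))"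

lemma path_count_upper:
  assumes F: "height_path (a + b) j F" and j: "j \<le> b"
  shows "path_count (k * m) y F \<le> greene_bound j k"
proof -
  let ?n = "k * m"
  \<comment> \<open>Paths may visit the empty rows before \<open>a\<close>. Capping the height at
    \<open>p - a\<close> pushes them into the nonempty rows without losing a letter;
    \<open>j \<le> b\<close> leaves room for all of them.\<close>
  define G where "G t p = min (F t p) (int (p - a))" for t p
  note D = height_pathD[OF F]
  have G: "height_path (a + b) j G"
    unfolding height_path_def
  proof (intro conjI allI impI)
    show "G t 0 = 0" "G t (a + b) = int j" for t using D(1,2)[of t] j by (auto simp: G_def)
    show "G t p \<le> G t (Suc p)" "G t (Suc p) \<le> G t p + 1" if "p < a + b" for t p
      using D(3,4)[OF that, of t] by (auto simp: G_def)
    show "G t p \<le> G (Suc t) p" if "p \<le> a + b" for t p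
      using D(5)[OF that, of t] by (auto simp: G_def)
  qed
  have z: "G t p = 0" if "p \<le> a" for t p
    using that height_path_bounds(1)[OF F, of p t] by (simp add: G_def)
  have "path_count ?n y F \<le> path_count ?n y G"
    unfolding path_count_def
  proof (intro sum_mono)
    fix t assume "t \<in> {1..?n}"
    then have t: "a \<le> y t" "y t < a + b" using letters by auto
    then have "int (Suc (y t) - a) = int (y t - a) + 1" by auto
    then show "F t (Suc (y t)) - F t (y t) \<le> G t (Suc (y t)) - G t (y t)"
      using D(3,4)[OF t(2), of t] unfolding G_def min_def by (simp split: if_splits)
  qed
  moreover have eq: "path_count ?n y G = int (j * k * r) + (\<Sum>q<b - 1. \<Sum>t<?n.
      (G (Suc t) (Suc (a + q)) - G t (Suc (a + q))) * excess y (a + q) t)"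
    by (rule path_count_clamped[OF G]) (rule z)
  have "path_count ?n y G \<le> greene_bound j k"
    unfolding eq greene_bound_def
  proof (intro add_left_mono sum_mono)
    fix q assume q: "q \<in> {..<b - 1}"
    define p where "p = Suc (a + q)"
    have i: "a \<le> a + q" "Suc (a + q) < a + b" and p: "p \<le> a + b" using q by (auto simp: p_def)
    have "(\<Sum>t<?n. (G (Suc t) p - G t p) * excess y (a + q) t)
        \<le> (\<Sum>t<?n. (G (Suc t) p - G t p) * max_excess (a + q))"
      using excess_le_max[OF i] height_pathD(5)[OF G p] by (intro sum_mono mult_left_mono) auto
    also have "\<dots> = max_excess (a + q) * (G ?n p - G 0 p)"
      using sum_lessThan_telescope[of "\<lambda>t. G t p" ?n] by (simp flip: sum_distrib_right)
    also have "\<dots> \<le> max_excess (a + q) * (min (int q + 1) (int j) - max 0 (int j + int q + 1 - int b))"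
    proof (rule mult_left_mono)
      show "0 \<le> max_excess (a + q)" using excess_le_max[OF i, of 0] by simp
      have "G ?n p \<le> int q + 1" by (simp add: G_def p_def)
      then show "G ?n p - G 0 p \<le> min (int q + 1) (int j) - max 0 (int j + int q + 1 - int b)"
        using height_path_bounds(1,3)[OF G p, of 0] height_path_bounds(2)[OF G p, of ?n] p q
        unfolding p_def by (simp add: of_nat_diff min_def max_def)
    qed
    finally show "(\<Sum>t<?n. (G (Suc t) (Suc (a + q)) - G t (Suc (a + q))) * excess y (a + q) t)
        \<le> max_excess (a + q) * (min (int q + 1) (int j) - max 0 (int j + int q + 1 - int b))"
      by (simp only: p_def)
  qed
  ultimately show ?thesis by linarith
qed

text \<open>Path \<open>s\<close> starts in the \<open>(b - j + s)\<close>-th row and makes its \<open>u\<close>-th move, across the boundary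
  \<open>p = b - j + s - u\<close>, in period \<open>s + u - 2\<close>, at a time where the excess at \<open>p\<close> is maximal;
  all moves fit into \<open>b - 1\<close> periods.\<close>

lemma path_count_attained:
  assumes j: "j \<le> b" and k: "k + 1 \<ge> b"
  shows "\<exists>F. height_path (a + b) j F \<and> path_count (k * m) y F = greene_bound j k"
proof -
  let ?n = "k * m"
  have "\<forall>p. \<exists>t<m. 1 \<le> p \<and> p < b \<longrightarrow> excess y (a + p - 1) t = max_excess (a + p - 1)"
  proof
    fix p
    show "\<exists>t<m. 1 \<le> p \<and> p < b \<longrightarrow> excess y (a + p - 1) t = max_excess (a + p - 1)"
    proof (cases "1 \<le> p \<and> p < b")
      case True
      then show ?thesis using max_excess_attained[of "a + p - 1"] by auto
    next
      case False
      then show ?thesis using m by (intro exI[of _ 0]) auto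
    qed
  qed
  then obtain \<theta> where \<theta>: "\<And>p. \<theta> p < m"
    and \<theta>max: "\<And>p. 1 \<le> p \<Longrightarrow> p < b \<Longrightarrow> excess y (a + p - 1) (\<theta> p) = max_excess (a + p - 1)"
    by metis
  define \<kappa> where "\<kappa> s p = int b + 2 * int s - int j - int p - 2" for s p
  \<comment> \<open>The paths standing before boundary \<open>p\<close> at time \<open>t\<close>.
    Path \<open>s\<close> ends in the \<open>s\<close>-th row, whence \<open>s \<le> p\<close>; it
    either starts before \<open>p\<close> or its crossing time has passed.\<close>
  define Z where "Z p t = {s\<in>{1..j}. s \<le> p \<and> (s + b \<le> p + j \<or> \<kappa> s p * int m + int (\<theta> p) < int t)}" for p t
  define F where "F t p = int (card (Z (p - a) t))" for t p
  have fin: "finite (Z p t)" for p t by (simp add: Z_def)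
  \<comment> \<open>Offsets are below \<open>m\<close>, so crossings in consecutive periods are in
    order whatever the optimal offsets are.\<close>
  have shift: "(\<kappa> s p - 1) * int m + int (\<theta> p') < \<kappa> s p * int m + int (\<theta> p'')" for s p p' p''
    using \<theta>[of p'] by (simp add: algebra_simps)
  have Z0: "Z 0 t = {}" and Zb: "Z b t = {1..j}" for t using j by (auto simp: Z_def)
  have Zsub: "Z p t \<subseteq> Z (Suc p) t" for p t
  proof
    fix s assume s: "s \<in> Z p t"
    have "\<kappa> s (Suc p) = \<kappa> s p - 1" by (simp add: \<kappa>_def)
    then show "s \<in> Z (Suc p) t" using s shift[of s p "Suc p" p] by (auto simp: Z_def)
  qed
  \<comment> \<open>Two paths never share a row: path \<open>s - 1\<close> crosses \<open>p\<close>
    one period before path \<open>s\<close> crosses \<open>p + 1\<close>.\<close>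
  have Zsup: "Z (Suc p) t \<subseteq> insert 1 (Suc ` Z p t)" for p t
  proof
    fix s assume s: "s \<in> Z (Suc p) t"
    show "s \<in> insert 1 (Suc ` Z p t)"
    proof (cases "s = 1")
      case False
      then obtain s' where s': "s = Suc s'" "1 \<le> s'" using s by (cases s) (auto simp: Z_def)
      have "\<kappa> s' p = \<kappa> s (Suc p) - 1" by (simp add: \<kappa>_def s')
      then have "s' \<in> Z p t" using s s' shift[of s "Suc p" p "Suc p"] by (auto simp: Z_def)
      then show ?thesis using s' by auto
    qed simp
  qed
  have Zmono: "Z p t \<subseteq> Z p (Suc t)" for p t by (auto simp: Z_def)
  have F: "height_path (a + b) j F"
    unfolding height_path_def
  proof (intro conjI allI impI)
    show "F t 0 = 0" "F t (a + b) = int j" for t by (simp_all add: F_def Z0 Zb)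
    show "F t p \<le> F t (Suc p)" for t p
      using card_mono[OF fin Zsub] by (cases "a \<le> p") (simp_all add: F_def Suc_diff_le)
    show "F t (Suc p) \<le> F t p + 1" for t p
    proof (cases "a \<le> p")
      case True
      have "card (Z (Suc (p - a)) t) \<le> card (insert 1 (Suc ` Z (p - a) t))"
        using Zsup fin by (intro card_mono) auto
      also have "\<dots> \<le> card (Z (p - a) t) + 1"
        using fin by (metis Suc_eq_plus1 card_image card_insert_le_m1 card_insert_if finite_imageI inj_Suc inj_on_subset le_Suc_eq order.refl subset_UNIV)
      finally show ?thesis using True by (simp add: F_def Suc_diff_le)
    qed (simp add: F_def Z0)
    show "F t p \<le> F (Suc t) p" for t p
      using card_mono[OF fin Zmono] by (simp add: F_def)
  qed
  have zero: "F t p = 0" if "p \<le> a" for t p using that by (simp add: F_def Z0)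
  have "(\<Sum>t<?n. (F (Suc t) (Suc (a + q)) - F t (Suc (a + q))) * excess y (a + q) t)
      = max_excess (a + q) * (min (int q + 1) (int j) - max 0 (int j + int q + 1 - int b))"
    if q: "q < b - 1" for q
  proof -
    define p where "p = Suc q"
    have p: "1 \<le> p" "p < b" "a + p - 1 = a + q" "Suc (a + q) - a = p" using q by (auto simp: p_def)
    have "(F (Suc t) (Suc (a + q)) - F t (Suc (a + q))) * excess y (a + q) t
        = (F (Suc t) (Suc (a + q)) - F t (Suc (a + q))) * max_excess (a + q)" for t
    proof (cases "Z p (Suc t) = Z p t")
      case True
      then show ?thesis unfolding F_def p by simp
    next
      case False
      then obtain s where "s \<in> Z p (Suc t)" "s \<notin> Z p t" using Zmono by blast
      then have t: "int t = \<kappa> s p * int m + int (\<theta> p)" by (auto simp: Z_def)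
      have "0 \<le> \<kappa> s p"
      proof (rule ccontr)
        assume "\<not> 0 \<le> \<kappa> s p"
        then have "\<kappa> s p * int m \<le> (-1) * int m" by (intro mult_right_mono) auto
        then show False using t \<theta>[of p] by simp
      qed
      then have "int t = int (nat (\<kappa> s p) * m + \<theta> p)" using t by simp
      then have "t = nat (\<kappa> s p) * m + \<theta> p" by (simp only: of_nat_eq_iff)
      then have "excess y (a + q) t = max_excess (a + q)"
        using excess_mult[of "a + q"] \<theta>max[OF p(1,2)] p q by simp
      then show ?thesis by simp
    qed
    then have "(\<Sum>t<?n. (F (Suc t) (Suc (a + q)) - F t (Suc (a + q))) * excess y (a + q) t)
      = (\<Sum>t<?n. F (Suc t) (Suc (a + q)) - F t (Suc (a + q))) * max_excess (a + q)"
      unfolding sum_distrib_right by (intro sum.cong refl)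
    also have "\<dots> = max_excess (a + q) * (F ?n (Suc (a + q)) - F 0 (Suc (a + q)))"
      using sum_lessThan_telescope[of "\<lambda>t. F t (Suc (a + q))" ?n] by simp
    also have "F ?n (Suc (a + q)) = min (int q + 1) (int j)"
    proof -
      have "\<kappa> s p * int m + int (\<theta> p) < int ?n" if "s \<le> j" "s \<le> p" for s
      proof -
        \<comment> \<open>Here \<open>k \<ge> b - 1\<close> enters: \<open>s \<le> j\<close> and
          \<open>s \<le> p\<close> bound the period by \<open>b - 2\<close>.\<close>
        have "\<kappa> s p + 1 \<le> int k" using that k unfolding \<kappa>_def by linarith
        then have "(\<kappa> s p + 1) * int m \<le> int k * int m" by (intro mult_right_mono) auto
        then show ?thesis using \<theta>[of p] by (simp add: algebra_simps)
      qed
      then have "Z p ?n = {1..min p j}" by (auto simp: Z_def)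
      then have "F ?n (Suc (a + q)) = int (min p j)" unfolding F_def p by simp
      then show ?thesis by (simp add: p_def of_nat_min)
    qed
    also have "F 0 (Suc (a + q)) = max 0 (int j + int q + 1 - int b)"
    proof -
      have "s + b \<le> p + j" if "1 \<le> s" "\<kappa> s p * int m + int (\<theta> p) < 0" for s
      proof (rule ccontr)
        assume "\<not> s + b \<le> p + j"
        then have "0 \<le> \<kappa> s p" using that(1) unfolding \<kappa>_def by linarith
        then have "0 \<le> \<kappa> s p * int m" by simp
        then show False using that(2) by simp
      qed
      then have "Z p 0 = {s\<in>{1..j}. s \<le> p \<and> s + b \<le> p + j}" by (auto simp: Z_def)
      also have "\<dots> = {1..p + j - b}" using j p(2) by auto
      finally have "Z p 0 = {1..p + j - b}" .
      then have "F 0 (Suc (a + q)) = int (p + j - b)" unfolding F_def p by simp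
      then show ?thesis by (simp add: p_def)
    qed
    finally show ?thesis .
  qed
  moreover have "path_count ?n y F = int (j * k * r) + (\<Sum>q<b - 1. \<Sum>t<?n.
      (F (Suc t) (Suc (a + q)) - F t (Suc (a + q))) * excess y (a + q) t)"
    by (rule path_count_clamped[OF F]) (rule zero)
  ultimately have "path_count ?n y F = greene_bound j k"
    unfolding greene_bound_def by simp
  then show ?thesis using F by blast
qed

lemma greene_periodic:
  assumes "j \<le> b" "k + 1 \<ge> b"
  shows "greene (a + b) (k * m) y j (greene_bound j k)"
  unfolding greene_def using path_count_upper path_count_attained assms by blast

end

section \<open>The first row of the insertion tableau\<close>

abbreviation row_step :: "nat list \<Rightarrow> nat \<Rightarrow> nat list" where
  "row_step R x \<equiv> fst (ins_row R x)"

lemma hd_foldl_row_insert: "hd (foldl row_insert (R # Rs) w) = foldl row_step R w"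
proof (induction w arbitrary: R Rs)
  case (Cons x w)
  obtain R' z where R': "ins_row R x = (R', z)" by fastforce
  then show ?case using Cons by (cases z) auto
qed simp

lemma hd_RS_P:
  assumes "w \<noteq> []"
  shows "hd (RS_P w) = foldl row_step [] w"
  using assms by (cases w) (simp_all add: RS_P_def hd_foldl_row_insert ins_row_def)

definition count_upto :: "nat set \<Rightarrow> nat \<Rightarrow> nat" where
  "count_upto M t = card {z\<in>M. z \<le> t}"

lemma count_upto_insert:
  assumes "finite M" "x \<notin> M"
  shows "count_upto (insert x M) t = count_upto M t + of_bool (x \<le> t)"
proof -
  have "{z\<in>insert x M. z \<le> t} = (if x \<le> t then insert x {z\<in>M. z \<le> t} else {z\<in>M. z \<le> t})" by auto
  then show ?thesis using assms by (simp add: count_upto_def)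
qed

lemma count_upto_mono: "finite M \<Longrightarrow> s \<le> t \<Longrightarrow> count_upto M s \<le> count_upto M t"
  unfolding count_upto_def by (intro card_mono) auto

lemma count_upto_gap: "s \<le> t \<Longrightarrow> (\<And>z. z \<in> M \<Longrightarrow> s < z \<Longrightarrow> t < z) \<Longrightarrow> count_upto M t = count_upto M s"
  unfolding count_upto_def by (intro arg_cong[where f = card]) (auto simp: not_le[symmetric])

text \<open>If \<open>x\<close> replaces \<open>z\<close>, the count rises by 1 exactly for
  \<open>x \<le> t < z\<close>, where it equalled the count at \<open>x\<close>; from
  \<open>z\<close> on it was already larger. The maximum expresses this, and the appending case too,
  without naming \<open>z\<close>.\<close>

lemma row_step_strict:
  assumes R: "sorted_wrt (<) R" and x: "x \<notin> set R"
  shows "sorted_wrt (<) (row_step R x)" and "set (row_step R x) \<subseteq> insert x (set R)"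
    and "count_upto (set (row_step R x)) t =
      (if t < x then count_upto (set R) t else max (count_upto (set R) t) (count_upto (set R) x + 1))"
proof -
  have "sorted_wrt (<) (row_step R x) \<and> set (row_step R x) \<subseteq> insert x (set R) \<and>
    count_upto (set (row_step R x)) t =
      (if t < x then count_upto (set R) t else max (count_upto (set R) t) (count_upto (set R) x + 1))"
  proof (cases "\<forall>y\<in>set R. y \<le> x")
    case True
    then have lt: "\<forall>y\<in>set R. y < x" using x by (metis order_le_less)
    have step: "row_step R x = R @ [x]" using True by (simp add: ins_row_def)
    have "count_upto (set R) t = count_upto (set R) x" if "x \<le> t"
      using that lt by (intro count_upto_gap) auto
    then show ?thesis unfolding step using R lt x
      by (auto simp: sorted_wrt_append count_upto_insert)
  next
    case False
    define p where "p = (LEAST p. p < length R \<and> x < R ! p)"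
    have "\<exists>p. p < length R \<and> x < R ! p" using False by (auto simp: in_set_conv_nth not_le)
    then have p: "p < length R" "x < R ! p" unfolding p_def by (metis (mono_tags, lifting) LeastI_ex)+
    have low: "R ! q < x" if "q < p" for q
    proof -
      have "\<not> x < R ! q" using not_less_Least[of q "\<lambda>p. p < length R \<and> x < R ! p"] that p
        unfolding p_def by auto
      moreover have "R ! q \<noteq> x" using x that p by auto
      ultimately show ?thesis by simp
    qed
    define A C z where "A = take p R" and "C = drop (Suc p) R" and "z = R ! p"
    have Req: "R = A @ z # C" using p by (simp add: A_def C_def z_def id_take_nth_drop[symmetric])
    have "row_step R x = R[p := x]" by (simp only: ins_row_def if_not_P[OF False] Let_def fst_conv p_def)
    then have step: "row_step R x = A @ x # C" using p by (simp add: A_def C_def upd_conv_take_nth_drop)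
    have A: "\<forall>u\<in>set A. u < x" using low p by (auto simp: A_def in_set_conv_nth)
    have z: "x < z" using p by (simp add: z_def)
    have s: "sorted_wrt (<) A" "sorted_wrt (<) C" "\<forall>u\<in>set C. z < u"
      using R unfolding Req by (auto simp: sorted_wrt_append)
    have zn: "z \<notin> set A \<union> set C" "x \<notin> set A \<union> set C" using s A z by auto
    have set: "set R = insert z (set A \<union> set C)" "set (row_step R x) = insert x (set A \<union> set C)"
      unfolding step by (simp_all add: Req)
    have "count_upto (set A \<union> set C) t = count_upto (set A \<union> set C) x" if "x \<le> t" "t < z"
      using that A s by (intro count_upto_gap) auto
    moreover have "count_upto (set A \<union> set C) x \<le> count_upto (set A \<union> set C) t" if "x \<le> t"
      using that by (intro count_upto_mono) auto
    ultimately have "count_upto (set (row_step R x)) t =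
      (if t < x then count_upto (set R) t else max (count_upto (set R) t) (count_upto (set R) x + 1))"
      unfolding set using zn z by (auto simp: count_upto_insert)
    moreover have "\<forall>u\<in>set A. \<forall>w\<in>set C. u < w" using A z s(3) by (meson less_trans)
    then have "sorted_wrt (<) (row_step R x)" unfolding step using s A z
      by (auto simp: sorted_wrt_append)
    ultimately show ?thesis using set by auto
  qed
  then show "sorted_wrt (<) (row_step R x)" and "set (row_step R x) \<subseteq> insert x (set R)"
    and "count_upto (set (row_step R x)) t =
      (if t < x then count_upto (set R) t else max (count_upto (set R) t) (count_upto (set R) x + 1))"
    by blast+
qed

lemma foldl_row_step_increasing:
  "sorted_wrt (<) u \<Longrightarrow> foldl row_step [] u = u"
proof (induction u rule: rev_induct)
  case (snoc x u)
  then show ?case by (auto simp: sorted_wrt_append ins_row_def)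
qed simp

text \<open>Schensted's theorem for two increasing words: an increasing subsequence takes
  \<open>u\<close> up to some \<open>s\<close> and \<open>v\<close> above \<open>s\<close>. The
  first row's count at \<open>t\<close> is the maximum over \<open>s \<le> t\<close>; keeping all
  \<open>t\<close> at once lets the recursion of \<open>row_step_strict\<close> close the
  induction.\<close>

lemma foldl_row_step_count:
  assumes "sorted_wrt (<) u" "sorted_wrt (<) v" "set u \<inter> set v = {}" "0 \<notin> set v"
  shows "sorted_wrt (<) (foldl row_step u v) \<and> set (foldl row_step u v) \<subseteq> set u \<union> set v \<and>
    (\<forall>t. (\<forall>s\<le>t. count_upto (set u) s + card {z\<in>set v. s < z \<and> z \<le> t} \<le> count_upto (set (foldl row_step u v)) t) \<and>
      (\<exists>s\<le>t. count_upto (set u) s + card {z\<in>set v. s < z \<and> z \<le> t} = count_upto (set (foldl row_step u v)) t))"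
  using assms(2-4)
proof (induction v rule: rev_induct)
  case Nil
  then show ?case using assms(1) count_upto_mono[of "set u"] by auto
next
  case (snoc x v)
  define R where "R = foldl row_step u v"
  define V where "V s t = card {z\<in>set v. s < z \<and> z \<le> t}" for s t
  define V' where "V' s t = card {z\<in>set (v @ [x]). s < z \<and> z \<le> t}" for s t
  define C where "C = count_upto (set R)"
  define C' where "C' = count_upto (set (row_step R x))"
  define U where "U = count_upto (set u)"
  have vx: "z < x" if "z \<in> set v" for z using snoc.prems that by (auto simp: sorted_wrt_append)
  have x: "x \<noteq> 0" "x \<notin> set u" "x \<notin> set v" using snoc.prems vx by auto
  have "sorted_wrt (<) v" "set u \<inter> set v = {}" "0 \<notin> set v"
    using snoc.prems by (auto simp: sorted_wrt_append)
  note IH = snoc.IH[OF this, folded R_def V_def C_def U_def]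
  have R: "sorted_wrt (<) R" "set R \<subseteq> set u \<union> set v"
    and lower: "\<And>s t. s \<le> t \<Longrightarrow> U s + V s t \<le> C t"
    and ex: "\<And>t. \<exists>s\<le>t. U s + V s t = C t"
    using IH by auto
  have xR: "x \<notin> set R" using R(2) x by auto
  note st = row_step_strict[OF R(1) xR, folded C_def C'_def]
  have V': "V' s t = V s t + of_bool (s < x \<and> x \<le> t)" for s t
  proof -
    have "{z\<in>set (v @ [x]). s < z \<and> z \<le> t} = (if s < x \<and> x \<le> t then insert x {z\<in>set v. s < z \<and> z \<le> t}
        else {z\<in>set v. s < z \<and> z \<le> t})" by auto
    then show ?thesis using x by (simp add: V_def V'_def)
  qed
  have Vx: "V s t = V s x" if "x \<le> t" for s t
  proof -
    have "{z\<in>set v. s < z \<and> z \<le> t} = {z\<in>set v. s < z \<and> z \<le> x}"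
      using vx that by (auto intro: less_imp_le less_le_trans)
    then show ?thesis by (simp add: V_def)
  qed
  have Vx0: "V s t = 0" if "x \<le> Suc s" for s t
  proof -
    have "{z\<in>set v. s < z \<and> z \<le> t} = {}" using vx that by (metis (mono_tags, lifting) Collect_empty_eq less_le_trans not_less_eq not_less)
    then show ?thesis by (simp add: V_def)
  qed
  have "U s + V' s t \<le> C' t" if "s \<le> t" for s t
  proof (cases "t < x")
    case True
    then show ?thesis using lower[OF that] V' st(3) by simp
  next
    case False
    then show ?thesis using lower[OF that] lower[of s x] V'[of s t] Vx[of t s] st(3)[of t] by auto
  qed
  moreover have "\<exists>s\<le>t. U s + V' s t = C' t" for t
  proof (cases "t < x")
    case True
    then show ?thesis using ex[of t] V' st(3)[of t] by auto
  next
    case False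
    then have tx: "x \<le> t" by simp
    show ?thesis
    proof (cases "C x + 1 \<le> C t")
      case True
      then have Ct: "C' t = C t" using st(3)[of t] tx by simp
      obtain s where s: "s \<le> t" "U s + V s t = C t" using ex by blast
      have "\<not> s < x"
        using lower[of s x] s Vx[OF tx, of s] True by auto
      then show ?thesis using s Ct V' by auto
    next
      case False
      then have Ct: "C' t = C x + 1" using st(3)[of t] tx by simp
      obtain s where s: "s \<le> x" "U s + V s x = C x" using ex by blast
      show ?thesis
      proof (cases "s = x")
        case True
        \<comment> \<open>The choice \<open>s = x\<close> would miss the new letter
          \<open>x\<close>. As \<open>x\<close> is not in \<open>u\<close>, \<open>s = x - 1\<close>
          does as well on \<open>u\<close> and counts it; this uses that \<open>x\<close> is
          positive.\<close>
        have "U x = U (x - 1)" unfolding U_def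
        proof (rule count_upto_gap)
          fix z assume "z \<in> set u" "x - 1 < z"
          then show "x < z" using x by (cases "z = x") auto
        qed simp
        then have "U (x - 1) + V' (x - 1) t = C' t"
          using Ct V' s True Vx0[of x] Vx0[of "x - 1"] tx x by simp
        then show ?thesis using tx by (intro exI[of _ "x - 1"]) auto
      next
        case False
        then show ?thesis using s Ct V' Vx[OF tx] tx by (intro exI[of _ s]) auto
      qed
    qed
  qed
  moreover have "set (row_step R x) \<subseteq> set u \<union> set (v @ [x])" using st(2) R(2) by auto
  moreover have "foldl row_step u (v @ [x]) = row_step R x" by (simp add: R_def)
  ultimately show ?case using st(1) unfolding U_def[symmetric] V'_def[symmetric] by (simp only: C'_def[symmetric]) blast
qed

lemma first_row_two_rows:
  assumes u: "sorted_wrt (<) u" "set u \<subseteq> {1..m}" and v: "sorted_wrt (<) v" "set v \<subseteq> {1..m}"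
    and disj: "set u \<inter> set v = {}" and ne: "u \<noteq> []"
  shows "int (length (hd (RS_P (u @ v)))) - int (length v) =
    Max ((\<lambda>s. int (count_upto (set u) s) - int (count_upto (set v) s)) ` {..m})"
proof -
  define R where "R = foldl row_step u v"
  have hd: "hd (RS_P (u @ v)) = R"
    using hd_RS_P[of "u @ v"] ne foldl_row_step_increasing[OF u(1)] by (simp add: R_def)
  have "0 \<notin> set v" using v(2) by auto
  note M = foldl_row_step_count[OF u(1) v(1) disj this, folded R_def]
  have len: "length R = count_upto (set R) m"
  proof -
    have "set R \<subseteq> set u \<union> set v" using M by blast
    then have "{z\<in>set R. z \<le> m} = set R" using u(2) v(2) by fastforce
    moreover have "distinct R" using M strict_sorted_iff by blast
    ultimately show ?thesis by (simp add: count_upto_def distinct_card)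
  qed
  have cv: "int (card {z\<in>set v. s < z \<and> z \<le> m}) = int (length v) - int (count_upto (set v) s)" for s
  proof -
    have "{z\<in>set v. s < z \<and> z \<le> m} = set v - {z\<in>set v. z \<le> s}" using v(2) by auto
    moreover have "card (set v) = length v" using v(1) by (simp add: strict_sorted_iff distinct_card)
    moreover have "card {z\<in>set v. z \<le> s} \<le> card (set v)" by (intro card_mono) auto
    ultimately show ?thesis by (simp add: count_upto_def card_Diff_subset of_nat_diff)
  qed
  show ?thesis unfolding hd
  proof (rule Max_eqI[symmetric])
    fix w assume "w \<in> (\<lambda>s. int (count_upto (set u) s) - int (count_upto (set v) s)) ` {..m}"
    then obtain s where s: "s \<le> m" "w = int (count_upto (set u) s) - int (count_upto (set v) s)" by auto
    then have "count_upto (set u) s + card {z\<in>set v. s < z \<and> z \<le> m} \<le> length R" unfolding len using M by blast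
    then show "w \<le> int (length R) - int (length v)" using cv[of s] s by linarith
  next
    obtain s where s: "s \<le> m" "count_upto (set u) s + card {z\<in>set v. s < z \<and> z \<le> m} = length R"
      using M len by metis
    then have "int (length R) - int (length v) = int (count_upto (set u) s) - int (count_upto (set v) s)"
      using cv[of s] by linarith
    then show "int (length R) - int (length v)
        \<in> (\<lambda>s. int (count_upto (set u) s) - int (count_upto (set v) s)) ` {..m}"
      using s(1) by (intro image_eqI[of _ _ s]) auto
  qed simp
qed

section \<open>Powers of a tableau with equal rows\<close>

lemma convex_cells_skew:
  fixes mu :: "nat \<Rightarrow> nat"
  assumes "\<And>i i'. a \<le> i \<Longrightarrow> i \<le> i' \<Longrightarrow> i' < a + b \<Longrightarrow> mu i' \<le> mu i"
  shows "convex_cells {(i, j). a \<le> i \<and> i < a + b \<and> mu i \<le> j \<and> j < mu i + L}"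
  unfolding convex_cells_def
proof (intro allI impI)
  let ?X = "{(i, j). a \<le> i \<and> i < a + b \<and> mu i \<le> j \<and> j < mu i + L}"
  fix c d e assume *: "c \<in> ?X" "d \<in> ?X" "c \<sqsubseteq> e" "e \<sqsubseteq> d"
  obtain i j i' j' p q where "c = (i, j)" "d = (i', j')" "e = (p, q)" by (cases c, cases d, cases e)
  then show "e \<in> ?X" using * assms[of i p] assms[of p i'] by auto
qed

text \<open>Convexity supplies the corner cell \<open>(i, j')\<close> between comparable cells, so
  rows and columns suffice.\<close>

lemma tableau_wordI:
  assumes "ran T = {1..n}" "convex_cells (dom T)"
    and inj: "\<And>c d v. T c = Some v \<Longrightarrow> T d = Some v \<Longrightarrow> c = d"
    and word: "\<And>i j v. T (i, j) = Some v \<Longrightarrow> i < B \<and> y v = i"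
    and rows: "\<And>i j j' u v. T (i, j) = Some u \<Longrightarrow> T (i, j') = Some v \<Longrightarrow> j < j' \<Longrightarrow> u < v"
    and cols: "\<And>i i' j u v. T (i, j) = Some u \<Longrightarrow> T (i', j) = Some v \<Longrightarrow> i < i' \<Longrightarrow> u < v"
  shows "tableau_word B n T y"
  unfolding tableau_word_def
proof (intro conjI allI impI)
  fix c d u v assume cd: "T c = Some u" "T d = Some v" "c \<sqsubseteq> d" "c \<noteq> d"
  obtain i j i' j' where ij: "c = (i, j)" "d = (i', j')" by (cases c, cases d)
  have "(i, j') \<in> dom T"
    by (rule convex_cellsD[OF assms(2), of c d]) (use cd ij in auto)
  then obtain w where w: "T (i, j') = Some w" by auto
  have "u \<le> w" using rows[of i j u j' w] cd w ij by (cases "j = j'") auto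
  moreover have "w \<le> v" using cols[of i j' w i' v] cd w ij by (cases "i = i'") auto
  moreover have "u < w \<or> w < v" using rows[of i j u j' w] cols[of i j' w i' v] cd w ij by (cases "j = j'") auto
  ultimately show "u < v" by linarith
qed (use assms in auto)

locale equal_row_tableau =
  fixes S :: tab and a b r :: nat and mu :: "nat \<Rightarrow> nat"
  assumes b: "b \<ge> 1" and r: "r \<ge> 1"
    and anti: "a \<le> i \<Longrightarrow> i \<le> i' \<Longrightarrow> i' < a + b \<Longrightarrow> mu i' \<le> mu i"
    and domS: "dom S = {(i, j). a \<le> i \<and> i < a + b \<and> mu i \<le> j \<and> j < mu i + r}"
    and std: "standard_tab S"
begin

abbreviation m :: nat where "m \<equiv> b * r"

lemma card_dom: "card (dom S) = m"
proof -
  have "dom S = (SIGMA i:{a..<a + b}. {mu i..<mu i + r})" unfolding domS by auto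
  then show ?thesis by simp
qed

lemma m_pos: "m \<ge> 1" using b r by simp

lemma ranS: "ran S = {1..m}" using std by (simp add: standard_tab_def card_dom)

lemma S_SomeD: "S (i, j) = Some v \<Longrightarrow> a \<le> i \<and> i < a + b \<and> mu i \<le> j \<and> j < mu i + r"
  using domS by (metis (mono_tags, lifting) case_prodD domI mem_Collect_eq)

lemma set_row_word: "set (row_word S i) = {v. \<exists>j. S (i, j) = Some v}"
proof -
  have "finite {j. (i, j) \<in> dom S}" unfolding domS by (rule finite_subset[of _ "{..<mu i + r}"]) auto
  then show ?thesis unfolding row_word_def by (force simp: image_iff)
qed

lemma S_inj: "S c = Some v \<Longrightarrow> S d = Some v \<Longrightarrow> c = d"
  using std unfolding standard_tab_def inj_on_def by (metis domI)

lemma S_row_less: "S (i, j) = Some u \<Longrightarrow> S (i, j') = Some v \<Longrightarrow> j < j' \<Longrightarrow> u < v"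
  using std unfolding standard_tab_def by (metis domI option.sel)

lemma S_col_less: "S (i, j) = Some u \<Longrightarrow> S (i', j) = Some v \<Longrightarrow> i < i' \<Longrightarrow> u < v"
  using std unfolding standard_tab_def by (metis domI option.sel)

lemma S_range: "S c = Some v \<Longrightarrow> 1 \<le> v \<and> v \<le> m"
  using ranS ranI[of S c v] by auto

text \<open>Extending the word of \<open>S\<close> with period \<open>m\<close> to all times lets
  one word serve every power.\<close>

definition word :: "nat \<Rightarrow> nat" where
  "word t = fst (SOME c. S c = Some (Suc ((t - 1) mod m)))"

lemma word_S: "S (i, j) = Some v \<Longrightarrow> word (v + q * m) = i"
proof -
  assume v: "S (i, j) = Some v"
  then obtain v' where v': "v = Suc v'" "v' < m" using S_range by (cases v) fastforce+
  then have "Suc ((v + q * m - 1) mod m) = v" by simp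
  moreover have "(SOME c. S c = Some v) = (i, j)" using v S_inj by (intro some_equality) auto
  ultimately show ?thesis by (simp add: word_def)
qed

lemma word_S0: "S (i, j) = Some v \<Longrightarrow> word v = i"
  using word_S[of i j v 0] by simp

lemma tableau_word_S: "tableau_word (a + b) m S word"
proof (rule tableau_wordI)
  show "convex_cells (dom S)" unfolding domS by (rule convex_cells_skew) (rule anti)
  show "i < a + b \<and> word v = i" if "S (i, j) = Some v" for i j v
    using word_S0[OF that] S_SomeD[OF that] by simp
qed (fact ranS S_inj S_row_less S_col_less)+

lemma letter_count_row: "t \<le> m \<Longrightarrow> letter_count word i t = int (count_upto (set (row_word S i)) t)"
proof -
  assume t: "t \<le> m"
  have "(\<exists>j. S (i, j) = Some v) \<longleftrightarrow> word v = i" if "1 \<le> v" "v \<le> m" for v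
  proof -
    have "v \<in> ran S" using ranS that by simp
    then obtain i' j' where ij: "S (i', j') = Some v" by (auto simp: ran_def)
    then show ?thesis using word_S0[OF ij] word_S0[of i _ v] by blast
  qed
  then have "{s\<in>{1..t}. word s = i} = {z\<in>set (row_word S i). z \<le> t}"
    using t S_range unfolding set_row_word by fastforce
  then show ?thesis by (simp add: letter_count_eq_card count_upto_def)
qed

sublocale periodic_word word a b r m
proof
  show "a \<le> word t \<and> word t < a + b" if "1 \<le> t" for t
  proof -
    have "Suc ((t - 1) mod m) \<in> ran S" using ranS m_pos by (auto simp: Suc_le_eq)
    then obtain i j where ij: "S (i, j) = Some (Suc ((t - 1) mod m))" by (auto simp: ran_def)
    have "t = Suc ((t - 1) mod m) + ((t - 1) div m) * m"
      using that mod_mult_div_eq[of "t - 1" m] by (simp add: mult.commute)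
    then have "word t = i" using word_S[OF ij, of "(t - 1) div m"] by metis
    then show ?thesis using S_SomeD[OF ij] by simp
  qed
  show "word (t + m) = word t" if "1 \<le> t" for t
  proof -
    have "(t + m - 1) mod m = (t - 1) mod m" using that
      by (metis Nat.add_diff_assoc2 mod_add_self2)
    then show ?thesis by (simp add: word_def)
  qed
  show "letter_count word i m = int r" if "a \<le> i" "i < a + b" for i
  proof -
    have "row_upto S i m = {mu i..<mu i + r}"
    proof -
      have "j \<in> row_upto S i m \<longleftrightarrow> (i, j) \<in> dom S" for j using S_range by (auto simp: row_upto_def)
      then show ?thesis using that domS by auto
    qed
    then show ?thesis using letter_count_cells[OF tableau_word_S order.refl, of i] by simp
  qed
qed (fact b m_pos)+

lemma row_word_props:
  assumes "a \<le> i" "i < a + b"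
  shows "sorted_wrt (<) (row_word S i)" "set (row_word S i) \<subseteq> {1..m}" "length (row_word S i) = r"
proof -
  have eq: "{j. (i, j) \<in> dom S} = {mu i..<mu i + r}" using assms domS by auto
  then have rw: "row_word S i = map (\<lambda>j. the (S (i, j))) [mu i..<mu i + r]"
    by (simp add: row_word_def)
  have ex: "\<exists>v. S (i, j) = Some v" if "mu i \<le> j" "j < mu i + r" for j
  proof -
    have "(i, j) \<in> dom S" using that eq by auto
    then show ?thesis by auto
  qed
  show "length (row_word S i) = r" by (simp add: rw)
  show "set (row_word S i) \<subseteq> {1..m}" using ex S_range unfolding rw by fastforce
  show "sorted_wrt (<) (row_word S i)"
    unfolding rw sorted_wrt_map
  proof (rule sorted_wrt_mono_rel[OF _ sorted_wrt_upt])
    fix j j' assume j: "j \<in> set [mu i..<mu i + r]" "j' \<in> set [mu i..<mu i + r]" "j < j'"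
    obtain u v where "S (i, j) = Some u" "S (i, j') = Some v" using j ex[of j] ex[of j'] by auto
    then show "the (S (i, j)) < the (S (i, j'))" using S_row_less j(3) by simp
  qed
qed

text \<open>This identifies the constants of the theorem with the maximal excesses: the lower row
  \<open>Suc i\<close> is inserted first and is the one counted positively in
  \<open>excess\<close>.\<close>

lemma first_row_excess:
  assumes i: "a \<le> i" "Suc i < a + b"
  shows "int (length (hd (RS_P (row_word S (Suc i) @ row_word S i)))) - int r = max_excess i"
proof -
  let ?u = "row_word S (Suc i)" and ?v = "row_word S i"
  have props: "a \<le> Suc i" "i < a + b" using i by auto
  note u = row_word_props[OF props(1) i(2)] and v = row_word_props[OF i(1) props(2)]
  have disj: "set ?u \<inter> set ?v = {}" unfolding set_row_word by (auto dest!: word_S0)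
  have "?u \<noteq> []" using u(3) r by auto
  then have "int (length (hd (RS_P (?u @ ?v)))) - int r =
      Max ((\<lambda>s. int (count_upto (set ?u) s) - int (count_upto (set ?v) s)) ` {..m})"
    using first_row_two_rows[OF u(1,2) v(1,2) disj] v(3) by simp
  also have "(\<lambda>s. int (count_upto (set ?u) s) - int (count_upto (set ?v) s)) ` {..m} = excess word i ` {..m}"
    by (intro image_cong) (simp_all add: excess_def letter_count_row)
  finally show ?thesis by (simp add: max_excess_def)
qed

section \<open>Cells and entries of the powers\<close>

lemma tab_pow_eq:
  "tab_pow S k (i, j) = (if a \<le> i \<and> i < a + b \<and> mu i \<le> j \<and> j < mu i + k * r
    then map_option (\<lambda>v. v + (j - mu i) div r * m) (S (i, mu i + (j - mu i) mod r)) else None)"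
proof (cases "a \<le> i \<and> i < a + b")
  case True
  then have eq: "{j. (i, j) \<in> dom S} = {mu i..<mu i + r}" using domS by auto
  have "Min {mu i..<mu i + r} = mu i" using r by (intro Min_eqI) auto
  then show ?thesis using True r unfolding tab_pow_def prod.case eq by (simp add: Let_def card_dom)
next
  case False
  then have "{j. (i, j) \<in> dom S} = {}" using domS by auto
  then show ?thesis using False unfolding tab_pow_def by (auto simp: Let_def)
qed

lemma S_defined: "a \<le> i \<Longrightarrow> i < a + b \<Longrightarrow> \<rho> < r \<Longrightarrow> \<exists>v. S (i, mu i + \<rho>) = Some v"
proof -
  assume "a \<le> i" "i < a + b" "\<rho> < r"
  then have "(i, mu i + \<rho>) \<in> dom S" unfolding domS by simp
  then show ?thesis by auto
qed

lemma tab_pow_SomeE: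
  assumes "tab_pow S k (i, j) = Some w"
  obtains q \<rho> v where "a \<le> i" "i < a + b" "q < k" "\<rho> < r" "j = mu i + (q * r + \<rho>)"
    "S (i, mu i + \<rho>) = Some v" "w = v + q * m"
proof -
  define q \<rho> where "q = (j - mu i) div r" and "\<rho> = (j - mu i) mod r"
  have ij: "a \<le> i" "i < a + b" "mu i \<le> j" "j < mu i + k * r"
    using assms unfolding tab_pow_eq by (auto split: if_splits)
  have "q < k" unfolding q_def using ij r by (intro less_mult_imp_div_less) auto
  moreover have "\<rho> < r" using r by (simp add: \<rho>_def)
  moreover have "j = mu i + (q * r + \<rho>)" using ij by (simp add: q_def \<rho>_def)
  moreover obtain v where v: "S (i, mu i + \<rho>) = Some v" using S_defined ij \<open>\<rho> < r\<close> by blast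
  moreover have "w = v + q * m" using assms ij v unfolding tab_pow_eq by (simp add: q_def \<rho>_def)
  ultimately show ?thesis using that ij by blast
qed

lemma tab_pow_SomeI:
  assumes "a \<le> i" "i < a + b" "q < k" "\<rho> < r" "S (i, mu i + \<rho>) = Some v"
  shows "tab_pow S k (i, mu i + (q * r + \<rho>)) = Some (v + q * m)"
proof -
  have "q * r + \<rho> < (q + 1) * r" using assms by simp
  also have "\<dots> \<le> k * r" using assms by (intro mult_right_mono) auto
  finally show ?thesis using assms unfolding tab_pow_eq by simp
qed

lemma dom_tab_pow: "dom (tab_pow S k) = {(i, j). a \<le> i \<and> i < a + b \<and> mu i \<le> j \<and> j < mu i + k * r}"
proof (intro equalityI subsetI)
  fix c assume "c \<in> dom (tab_pow S k)"
  then show "c \<in> {(i, j). a \<le> i \<and> i < a + b \<and> mu i \<le> j \<and> j < mu i + k * r}"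
    by (cases c) (auto simp: tab_pow_eq split: if_splits)
next
  fix c assume "c \<in> {(i, j). a \<le> i \<and> i < a + b \<and> mu i \<le> j \<and> j < mu i + k * r}"
  then obtain i j where c: "c = (i, j)" "a \<le> i" "i < a + b" "mu i \<le> j" "j < mu i + k * r" by auto
  then show "c \<in> dom (tab_pow S k)" using S_defined[of i "(j - mu i) mod r"] r by (auto simp: tab_pow_eq)
qed

lemma shifted_less:
  assumes "1 \<le> u" "u \<le> m" "1 \<le> v" "q < q'"
  shows "u + q * m < v + q' * m"
proof -
  have "u + q * m \<le> (q + 1) * m" using assms by simp
  also have "\<dots> \<le> q' * m" using assms by (intro mult_right_mono) auto
  finally show ?thesis using assms by simp
qed

lemma tableau_word_tab_pow: "tableau_word (a + b) (k * m) (tab_pow S k) word"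
proof (rule tableau_wordI)
  show "convex_cells (dom (tab_pow S k))"
    unfolding dom_tab_pow by (rule convex_cells_skew) (rule anti)
  show "ran (tab_pow S k) = {1..k * m}"
  proof (intro equalityI subsetI)
    fix w assume "w \<in> ran (tab_pow S k)"
    then obtain i j where "tab_pow S k (i, j) = Some w" by (auto simp: ran_def)
    then obtain q \<rho> v where w: "q < k" "S (i, mu i + \<rho>) = Some v" "w = v + q * m"
      by (rule tab_pow_SomeE)
    then have "w \<le> (q + 1) * m" using S_range[OF w(2)] by simp
    also have "\<dots> \<le> k * m" using w by (intro mult_right_mono) auto
    finally show "w \<in> {1..k * m}" using S_range[OF w(2)] w by simp
  next
    fix w assume w: "w \<in> {1..k * m}"
    define q v where "q = (w - 1) div m" and "v = Suc ((w - 1) mod m)"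
    have wq: "w = v + q * m" using w mod_mult_div_eq[of "w - 1" m] by (simp add: q_def v_def mult.commute)
    have "q < k" unfolding q_def using w m_pos by (intro less_mult_imp_div_less) auto
    have "v \<in> ran S" using ranS m_pos by (auto simp: v_def Suc_le_eq)
    then obtain i j where ij: "S (i, j) = Some v" by (auto simp: ran_def)
    then have d: "a \<le> i" "i < a + b" "mu i \<le> j" "j < mu i + r" using S_SomeD[OF ij] by auto
    have "tab_pow S k (i, mu i + (q * r + (j - mu i))) = Some (v + q * m)"
      using d ij \<open>q < k\<close> by (intro tab_pow_SomeI) auto
    then show "w \<in> ran (tab_pow S k)" unfolding wq by (rule ranI)
  qed
  show "c = d" if c: "tab_pow S k c = Some w" and d: "tab_pow S k d = Some w" for c d w
  proof -
    obtain i j i' j' where ij: "c = (i, j)" "d = (i', j')" by (cases c, cases d)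
    obtain q \<rho> v where 1: "j = mu i + (q * r + \<rho>)" "S (i, mu i + \<rho>) = Some v" "w = v + q * m"
      using c unfolding ij by (rule tab_pow_SomeE)
    obtain q' \<rho>' v' where 2: "j' = mu i' + (q' * r + \<rho>')" "S (i', mu i' + \<rho>') = Some v'" "w = v' + q' * m"
      using d unfolding ij by (rule tab_pow_SomeE)
    have "q = q'" using shifted_less[of v v' q q'] shifted_less[of v' v q' q] 1 2 S_range
      by (metis less_irrefl linorder_neqE_nat)
    then have "v = v'" using 1 2 by simp
    then show "c = d" using S_inj[OF 1(2)] 2 1 ij \<open>q = q'\<close> by auto
  qed
  show "i < a + b \<and> word w = i" if "tab_pow S k (i, j) = Some w" for i j w
    using that by (rule tab_pow_SomeE) (auto dest: word_S)
  have less: "u < v" if T: "tab_pow S k (i, j) = Some u" "tab_pow S k (i', j') = Some v"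
    and le: "i \<le> i'" "j \<le> j'" "i = i' \<or> j = j'" "(i, j) \<noteq> (i', j')" for i j i' j' u v
  proof -
    obtain q \<rho> w where 1: "a \<le> i" "i < a + b" "\<rho> < r" "j = mu i + (q * r + \<rho>)"
      "S (i, mu i + \<rho>) = Some w" "u = w + q * m"
      using T(1) by (rule tab_pow_SomeE)
    obtain q' \<rho>' w' where 2: "a \<le> i'" "i' < a + b" "\<rho>' < r" "j' = mu i' + (q' * r + \<rho>')"
      "S (i', mu i' + \<rho>') = Some w'" "v = w' + q' * m"
      using T(2) by (rule tab_pow_SomeE)
    \<comment> \<open>In a common column the lower row starts no further right, so its cell has the
      larger offset and lies in the same or a later copy.\<close>
    have le': "q * r + \<rho> \<le> q' * r + \<rho>'" using 1 2 le anti[of i i'] by linarith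
    have "q \<le> q'"
    proof (rule ccontr)
      assume "\<not> q \<le> q'"
      then have "(q' + 1) * r \<le> q * r" by (intro mult_right_mono) auto
      then show False using le' 2(3) by simp
    qed
    show "u < v"
    proof (cases "q = q'")
      case True
      have "w < w'"
      proof (cases "i = i'")
        case True
        then show ?thesis using S_row_less[OF 1(5), of "mu i' + \<rho>'" w'] 1(4) 2(4,5) le \<open>q = q'\<close> by auto
      next
        case False
        then have "mu i + \<rho> = mu i' + \<rho>'" using 1(4) 2(4) le(3) \<open>q = q'\<close> by simp
        then show ?thesis using S_col_less[OF 1(5), of i' w'] 2(5) le(1) False by simp
      qed
      then show ?thesis using 1 2 True by simp
    next
      case False
      then show ?thesis using shifted_less[of w w' q q'] 1 2 S_range \<open>q \<le> q'\<close> by simp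
    qed
  qed
  show "u < v" if "tab_pow S k (i, j) = Some u" "tab_pow S k (i, j') = Some v" "j < j'" for i j j' u v
    using less[OF that(1,2)] that(3) by simp
  show "u < v" if "tab_pow S k (i, j) = Some u" "tab_pow S k (i', j) = Some v" "i < i'" for i i' j u v
    using less[OF that(1,2)] that(3) by simp
qed

text \<open>From \<open>j\<close> to \<open>j + 1\<close> the \<open>min\<close> gains 1 for
  \<open>q \<ge> j\<close> and the \<open>max\<close> gains 1 for \<open>q + j + 1 \<ge> b\<close>.
  The reflection \<open>l = b - 1 - q\<close> passes to boundaries numbered from the bottom.\<close>

lemma greene_bound_Suc:
  assumes j: "j < b"
  shows "greene_bound (Suc j) k - greene_bound j k = int (k * r)
    + (\<Sum>l=1..b - Suc j. max_excess (a + b - 1 - l)) - (\<Sum>l=1..j. max_excess (a + b - 1 - l))"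
proof -
  let ?e = "\<lambda>q. max_excess (a + q)"
  have "(\<Sum>q<b - 1. ?e q * (min (int q + 1) (int (Suc j)) - max 0 (int (Suc j) + int q + 1 - int b)))
      - (\<Sum>q<b - 1. ?e q * (min (int q + 1) (int j) - max 0 (int j + int q + 1 - int b)))
    = (\<Sum>q<b - 1. (if j \<le> q then ?e q else 0)) - (\<Sum>q<b - 1. (if b \<le> j + q + 1 then ?e q else 0))"
    unfolding sum_subtractf[symmetric]
  proof (intro sum.cong refl)
    fix q
    have "(min (int q + 1) (int (Suc j)) - max 0 (int (Suc j) + int q + 1 - int b))
        - (min (int q + 1) (int j) - max 0 (int j + int q + 1 - int b)) = of_bool (j \<le> q) - of_bool (b \<le> j + q + 1)"
      by (auto simp: min_def max_def)
    then show "?e q * (min (int q + 1) (int (Suc j)) - max 0 (int (Suc j) + int q + 1 - int b))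
        - ?e q * (min (int q + 1) (int j) - max 0 (int j + int q + 1 - int b))
      = (if j \<le> q then ?e q else 0) - (if b \<le> j + q + 1 then ?e q else 0)"
      unfolding right_diff_distrib[symmetric] by simp
  qed
  also have "(\<Sum>q<b - 1. (if j \<le> q then ?e q else 0)) = (\<Sum>q\<in>{q. q < b - 1 \<and> j \<le> q}. ?e q)"
    by (intro sum.mono_neutral_cong_right) auto
  also have "\<dots> = (\<Sum>l=1..b - Suc j. max_excess (a + b - 1 - l))"
    by (rule sum.reindex_bij_witness[of _ "\<lambda>l. b - 1 - l" "\<lambda>q. b - 1 - q"]) auto
  also have "(\<Sum>q<b - 1. (if b \<le> j + q + 1 then ?e q else 0)) = (\<Sum>q\<in>{q. q < b - 1 \<and> b \<le> j + q + 1}. ?e q)"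
    by (intro sum.mono_neutral_cong_right) auto
  also have "\<dots> = (\<Sum>l=1..j. max_excess (a + b - 1 - l))"
    by (rule sum.reindex_bij_witness[of _ "\<lambda>l. b - 1 - l" "\<lambda>q. b - 1 - q"]) (use j in auto)
  finally show ?thesis unfolding greene_bound_def by (simp add: algebra_simps)
qed

lemma greene_bound_b: "greene_bound b k = int (k * m)"
proof -
  have "(\<Sum>q<b - 1. max_excess (a + q) * (min (int q + 1) (int b) - max 0 (int b + int q + 1 - int b))) = 0"
    by (intro sum.neutral) auto
  then show ?thesis unfolding greene_bound_def by (simp add: mult_ac)
qed

lemma shape_rect_tab_pow:
  assumes k: "k + 1 \<ge> b"
    and lam: "\<And>j. j < b \<Longrightarrow> lam (Suc j) = greene_bound (Suc j) k - greene_bound j k"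
  shows "has_shape (rect (tab_pow S k)) b lam"
proof -
  let ?n = "k * m" and ?R = "rect (tab_pow S k)"
  have "convex_cells (dom (tab_pow S k))"
    unfolding dom_tab_pow by (rule convex_cells_skew) (rule anti)
  from rect_aux_correct[OF tableau_word_tab_pow this order.refl] obtain z
    where z: "tableau_word (a + b) ?n ?R z" "greene_preserving (a + b) ?n word z" "holes ?R = {}"
    unfolding rect_def by blast
  have B: "a + b \<ge> 1" using b by simp
  have partial: "(\<Sum>i<j. letter_count z i ?n) = greene_bound j k" if "j \<le> b" for j
  proof (rule greene_unique)
    show "greene (a + b) ?n z j (\<Sum>i<j. letter_count z i ?n)"
      using straight_tableau(1)[OF z(1,3) B] that by simp
    show "greene (a + b) ?n z j (greene_bound j k)"
      using greene_periodic[OF that k] z(2) unfolding greene_preserving_def by blast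
  qed
  have row: "letter_count z i ?n = lam (Suc i)" if "i < b" for i
    using partial[of "Suc i"] partial[of i] lam[OF that] that by simp
  have nonneg: "0 \<le> letter_count z i ?n" for i by (simp add: letter_count_eq_card)
  \<comment> \<open>The first \<open>b\<close> rows already hold all \<open>k * m\<close> entries,
    by \<open>greene_bound_b\<close>.\<close>
  have rest: "letter_count z i ?n = 0" if "b \<le> i" "i < a + b" for i
  proof -
    have "z t < a + b" if "t \<in> {1..?n}" for t
    proof -
      have "t \<in> ran ?R" using tableau_wordD(1)[OF z(1)] that by simp
      then obtain c where "?R c = Some t" by (auto simp: ran_def)
      then show ?thesis using tableau_wordD(3,4)[OF z(1), of c t] by simp
    qed
    then have "(\<Sum>i<a + b. letter_count z i ?n) = (\<Sum>t=1..?n. 1)"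
      unfolding letter_count_def by (subst sum.swap) (intro sum.cong, auto)
    then have tot: "(\<Sum>i<a + b. letter_count z i ?n) = int ?n" by simp
    have "(\<Sum>i\<in>insert i {..<b}. letter_count z i ?n) \<le> (\<Sum>i<a + b. letter_count z i ?n)"
      using that nonneg by (intro sum_mono2) auto
    then have "letter_count z i ?n \<le> 0"
      using that partial[of b] greene_bound_b[of k] tot by simp
    then show ?thesis using nonneg[of i] by simp
  qed
  have "dom ?R = {(i, j). i < b \<and> int j < lam (i + 1)}"
  proof -
    have "i < a + b \<and> int j < letter_count z i ?n \<longleftrightarrow> i < b \<and> int j < lam (i + 1)" for i j
      using row[of i] rest[of i] by (cases "i < b") auto
    then show ?thesis unfolding straight_tableau(2)[OF z(1,3) B] by simp
  qed
  moreover have "0 \<le> lam j" if "1 \<le> j" "j \<le> b" for j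
    using row[of "j - 1"] nonneg[of "j - 1"] that by simp
  ultimately show ?thesis unfolding has_shape_def by blast
qed

end

theorem theorem1p6:
  fixes S :: tab and b r k a :: nat and mu :: "nat \<Rightarrow> nat"
  assumes "b \<ge> 1" and "r \<ge> 1"
    and "\<forall>i i'. a \<le> i \<longrightarrow> i \<le> i' \<longrightarrow> i' < a + b \<longrightarrow> mu i' \<le> mu i"
    and "dom S = {(i,j). a \<le> i \<and> i < a + b \<and> mu i \<le> j \<and> j < mu i + r}"
    and "standard_tab S"
    and "k \<ge> 1" and "k + 1 \<ge> b"
  shows "let w = (\<lambda>l. row_word S (a + b - l));
             c = (\<lambda>l. int (length (hd (RS_P (w l @ w (l+1))))) - int r);
             lam = (\<lambda>j. int (k * r) + (\<Sum>l=1..b-j. c l) - (\<Sum>l=1..j-1. c l))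
         in has_shape (rect (tab_pow S k)) b lam"
proof -
  interpret equal_row_tableau S a b r mu
    using assms by unfold_locales auto
  \<comment> \<open>The \<open>l\<close>-th row from the bottom has index \<open>a + b - l\<close>,
    so rows \<open>l\<close> and \<open>l + 1\<close> meet at the boundary with index
    \<open>a + b - 1 - l\<close>.\<close>
  have c: "int (length (hd (RS_P (row_word S (a + b - l) @ row_word S (a + b - (l + 1)))))) - int r
      = max_excess (a + b - 1 - l)" if "1 \<le> l" "l < b" for l
  proof -
    have "Suc (a + b - 1 - l) = a + b - l" "a + b - (l + 1) = a + b - 1 - l" using that by auto
    then show ?thesis using first_row_excess[of "a + b - 1 - l"] that by simp
  qed
  show ?thesis
    unfolding Let_def
  proof (rule shape_rect_tab_pow[OF assms(7)])
    fix j assume j: "j < b"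
    show "int (k * r) + (\<Sum>l=1..b - Suc j. int (length (hd (RS_P (row_word S (a + b - l) @ row_word S (a + b - (l + 1)))))) - int r)
        - (\<Sum>l=1..Suc j - 1. int (length (hd (RS_P (row_word S (a + b - l) @ row_word S (a + b - (l + 1)))))) - int r)
      = greene_bound (Suc j) k - greene_bound j k"
      unfolding greene_bound_Suc[OF j] using j
      by (intro arg_cong2[where f = "(-)"] arg_cong2[where f = "(+)"] sum.cong refl c) auto
  qed
qed

end
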